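(* Under the standing setting and assumptions (A0)–(A3) below, assume in addition (A4): there is $\sigma>0$ with $\mathbb E\big[\|A_{\lambda_n}(\xi_{n+1},x_n)\|^2_{x_{n+1}}\big]\leq\sigma$ for all $n\in\mathbb N$. Let $\lambda_n:=1/(\underline\alpha(n+2))$, let $\Lambda>\sum_{n=0}^\infty\lambda_n^2$, $c>0$ with $c>\int\|\phi^*\|^2_{x^*}\,d\mu$, $b\geq\mathbb E[d^2(x_0,x^* )]$, and $u:=\max\{4\sigma+2c,\ \lceil4/\underline\alpha^2\rceil(b+c\Lambda)\}$. Then for all $n\in\mathbb N$ and $\varepsilon>0$, \[ \mathbb E[d^2(x_n,x^* )]\leq\frac{u}{n+2}\quad\text{and}\quad \mathbb P\big(\exists m\geq n\ \ d^2(x_m,x^* )\geq\varepsilon\big)\leq\frac1\varepsilon\cdot\frac{e^{2\Lambda}(u+4\sigma+2c)}{n+2}. \]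
   Context: Geometry. A Hadamard space is a complete CAT(0) space: a geodesic metric space $(X,d)$ with $d^2(\gamma(tl),x)\leq (1-t)d^2(\gamma(0),x)+td^2(\gamma(l),x)-t(1-t)d^2(\gamma(0),\gamma(l))$ for all $x\in X$, geodesics $\gamma:[0,l]\to X$, $t\in[0,1]$; it is uniquely geodesic, $\gamma_{x,y}$ denoting the geodesic from $x$ to $y$. For $x\in X$, $\angle_x(\gamma,\eta):=\lim_{s,t\to0^+}\bar\angle_x(\gamma(s),\eta(t))$ is the Aleksandrov angle between nonconstant geodesics issuing from $x$; $\Sigma_xX$ is the completion of such geodesics modulo $\angle_x=0$; the tangent space $T_xX$ is the Euclidean cone over $\Sigma_xX$ (elements $t\gamma$, $t\ge0$, all $0\gamma$ identified to $0_x$, $\lambda(t\gamma):=(\lambda t)\gamma$), with metric $d_x(t\gamma,s\eta)=\sqrt{t^2+s^2-2ts\cos\angle_x(\gamma,\eta)}$, $\|t\gamma\|_x=t$, $g_x(t\gamma,s\eta)=ts\cos\angle_x(\gamma,\eta)$; $TX=\bigcup_xT_xX$. $\log_x:X\to T_xX$, $\log_xa:=d(x,a)\gamma_{x,a}$ ($a\ne x$), $\log_xx:=0_x$. Vector fields. $A:X\to2^{TX}$ with $A(x)\subseteq T_xX$ is monotone if $g_x(u,\log_xy)\le-g_y(v,\log_yx)$ for all $u\in A(x),v\in A(y)$, and strongly monotone with modulus $\alpha>0$ if $g_x(u,\log_xy)\le-g_y(v,\log_yx)-\alpha d^2(x,y)$. For monotone $A$ and $\lambda>0$, the resolvent $J_\lambda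 x$ is the unique $z$ with $\tfrac1\lambda\log_zx\in A(z)$ (if it exists); $A$ satisfies the surjectivity condition if such $z$ exists for all $\lambda>0,x\in X$. The Yosida approximate is $A_\lambda x:=\tfrac1\lambda\log_{J_\lambda x}x\in T_{J_\lambda x}X$. Integration. For a probability space and a separable Hadamard space $Y$, $L^p$ consists of measurable $Y$-valued maps with finite $p$-th moment of distance; the integral/expectation of an $L^1$ map is the barycenter of its distribution (minimizer of $z\mapsto\int(d^2(z,w)-d^2(w,y))$), and conditional expectation $\mathbb E[x\mid\mathcal G]$ of $x\in L^2$ is the $\mathcal G$-measurable $L^2$ map minimizing $\int d^2(z,x)$ (extended continuously to $L^1$); this applies to $Y=X$ and $Y=T_xX$. Standing setting. $(E,\mathcal E,\mu)$ and $(\Omega,\mathcal F,\mathbb P)$ are probability spaces; $X$ is a separable Hadamard space with every $T_xX$ separable. $A:E\times X\to2^{TX}$, $A(s,x)\subseteq T_xX$, is a random monotone vector field: each $A(s,\cdot)$ is monotone and $s\mapsto J_\lambda(s,x)$ is $\mathcal E/\mathcal B(X)$-measurable for every $x,\lambda$, where $J_\lambda(s,\cdot)$, $A_\lambda(s,\cdot)$ denote resolvent and Yosida approximate of $A(s,\cdot)$; moreover each $A(s,\cdot)$ satisfies the surjectivity condition. For $x\in X$, $S^p_A(x)$ is the set of measurable $\phi:E\to T_xX$ with $\phi(s)\in A(s,x)$ for all $s$ and $\phi\in L^p(E,T_xX,\mu)$; the mean field is $\underline A(x):=\{\int\phi\,d\mu\mid\phi\in S^1_A(x)\}$; $\mathcal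 Z_A(2):=\{x\mid\exists\phi\in S^2_A(x),\ \int\phi\,d\mu=0_x\}$. Given $x_0\in X$, $(\lambda_n)\subseteq(0,\infty)$ and random variables $\xi_n:\Omega\to E$, the iteration is $x_{n+1}:=J_{\lambda_n}(\xi_{n+1},x_n)$; $\mathcal F_n:=\sigma(\xi_1,\dots,\xi_n)$ ($\mathcal F_0$ trivial), $\mathbb E_n[\cdot]:=\mathbb E[\cdot\mid\mathcal F_n]$. Note $\|A_{\lambda_n}(\xi_{n+1},x_n)\|_{x_{n+1}}=d(x_n,x_{n+1})/\lambda_n$. Assumptions. (A0) $\sum_n\lambda_n^2<\infty$, $\sum_n\lambda_n=\infty$, and $(\xi_{n+1})$ is i.i.d. with distribution $\mu$. (A1) each $A(s,\cdot)$ is strongly monotone with modulus $\alpha(s)\in(0,1]$, where $\alpha:E\to(0,1]$ is measurable with $\underline\alpha:=\int\alpha\,d\mu>0$. (A2) $\underline A$ has a zero $x^*$ (i.e. $0_{x^*}\in\underline A(x^* )$) with $x^*\in\mathcal Z_A(2)$; a fixed $\phi^*\in S^2_A(x^* )$ with $\int\phi^*\,d\mu=0_{x^*}$ is chosen. (A3) $\mathbb E_n[g_{x^*}(\phi^*(\xi_{n+1}),\log_{x^*}x_n)]=0$ a.s. for every $n\in\mathbb N$. *)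

theory Defs
  imports "HOL-Probability.Probability"
begin

definition geodesic_seg :: "(real \<Rightarrow> 'a::metric_space) \<Rightarrow> real \<Rightarrow> bool" where
  "geodesic_seg \<gamma> l \<longleftrightarrow> l \<ge> 0 \<and>
     (\<forall>s\<in>{0..l}. \<forall>t\<in>{0..l}. dist (\<gamma> s) (\<gamma> t) = \<bar>s - t\<bar>)"

definition geodesic_space :: "'a::metric_space itself \<Rightarrow> bool" where
  "geodesic_space _ \<longleftrightarrow> (\<forall>x y::'a. \<exists>\<gamma>. geodesic_seg \<gamma> (dist x y) \<and> \<gamma> 0 = x \<and> \<gamma> (dist x y) = y)"

definition CAT0 :: "'a::metric_space itself \<Rightarrow> bool" where
  "CAT0 _ \<longleftrightarrow> (\<forall>(x::'a) \<gamma> l t. geodesic_seg \<gamma> l \<and> 0 \<le> t \<and> t \<le> 1 \<longrightarrow>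
      (dist (\<gamma> (t * l)) x)\<^sup>2 \<le> (1 - t) * (dist (\<gamma> 0) x)\<^sup>2 + t * (dist (\<gamma> l) x)\<^sup>2
         - t * (1 - t) * (dist (\<gamma> 0) (\<gamma> l))\<^sup>2)"

text \<open>Hadamard space: complete (type class complete_space) geodesic CAT(0) space.
  Separability is the type class second_countable_topology.\<close>
definition hadamard :: "'a::complete_space itself \<Rightarrow> bool" where
  "hadamard T \<longleftrightarrow> geodesic_space T \<and> CAT0 T"

text \<open>The point at distance s from x on the (unique) geodesic from x to a.\<close>
definition gpt :: "'a::metric_space \<Rightarrow> 'a \<Rightarrow> real \<Rightarrow> 'a" where
  "gpt x a s = (THE p. dist x p = s \<and> dist p a = dist x a - s)"

definition cangle :: "'a::metric_space \<Rightarrow> 'a \<Rightarrow> 'a \<Rightarrow> real" where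
  "cangle x p q = arccos (((dist x p)\<^sup>2 + (dist x q)\<^sup>2 - (dist p q)\<^sup>2) / (2 * dist x p * dist x q))"

text \<open>Aleksandrov angle at x between the geodesics from x to a and from x to b
  (a, b different from x); every nonconstant geodesic issuing from x is (a
  reparametrisation of an initial piece of) such a geodesic.\<close>
definition aangle :: "'a::metric_space \<Rightarrow> 'a \<Rightarrow> 'a \<Rightarrow> real" where
  "aangle x a b = Lim (at_right 0 \<times>\<^sub>F at_right 0) (\<lambda>(s,t). cangle x (gpt x a s) (gpt x b t))"

text \<open>Pre-tangent cone at x: pairs (t,a) standing for t times the direction of the
  geodesic from x to a (a = x encodes the cone point). Its metric/inner product/norm:\<close>
definition cinner :: "'a::metric_space \<Rightarrow> real \<times> 'a \<Rightarrow> real \<times> 'a \<Rightarrow> real" where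
  "cinner x v w = (if snd v = x \<or> snd w = x then 0 else fst v * fst w * cos (aangle x (snd v) (snd w)))"

definition cnorm :: "'a::metric_space \<Rightarrow> real \<times> 'a \<Rightarrow> real" where
  "cnorm x v = (if snd v = x then 0 else fst v)"

definition cdist :: "'a::metric_space \<Rightarrow> real \<times> 'a \<Rightarrow> real \<times> 'a \<Rightarrow> real" where
  "cdist x v w = sqrt ((cnorm x v)\<^sup>2 + (cnorm x w)\<^sup>2 - 2 * cinner x v w)"

text \<open>Tangent space T_x X: the metric completion of the pre-tangent cone, represented by
  Cauchy sequences; two representatives denote the same vector iff tdist is 0.\<close>
type_synonym 'a tvec = "nat \<Rightarrow> real \<times> 'a"

definition tangent :: "'a::metric_space \<Rightarrow> 'a tvec set" where
  "tangent x = {v. (\<forall>n. fst (v n) \<ge> 0) \<and>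
      (\<forall>e>0. \<exists>N. \<forall>m\<ge>N. \<forall>n\<ge>N. cdist x (v m) (v n) < e)}"

definition tdist :: "'a::metric_space \<Rightarrow> 'a tvec \<Rightarrow> 'a tvec \<Rightarrow> real" where
  "tdist x v w = lim (\<lambda>n. cdist x (v n) (w n))"

definition tinner :: "'a::metric_space \<Rightarrow> 'a tvec \<Rightarrow> 'a tvec \<Rightarrow> real" where
  "tinner x v w = lim (\<lambda>n. cinner x (v n) (w n))"

definition tnorm :: "'a::metric_space \<Rightarrow> 'a tvec \<Rightarrow> real" where
  "tnorm x v = lim (\<lambda>n. cnorm x (v n))"

definition tzero :: "'a \<Rightarrow> 'a tvec" where
  "tzero x = (\<lambda>n. (0, x))"

definition tscale :: "real \<Rightarrow> 'a tvec \<Rightarrow> 'a tvec" where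
  "tscale c v = (\<lambda>n. (c * fst (v n), snd (v n)))"

definition tlog :: "'a::metric_space \<Rightarrow> 'a \<Rightarrow> 'a tvec" where
  "tlog x a = (\<lambda>n. (dist x a, a))"

definition tmem :: "'a::metric_space \<Rightarrow> 'a tvec \<Rightarrow> 'a tvec set \<Rightarrow> bool" where
  "tmem x u S \<longleftrightarrow> (\<exists>w\<in>S. tdist x u w = 0)"

definition tangent_separable :: "'a::metric_space \<Rightarrow> bool" where
  "tangent_separable x \<longleftrightarrow> (\<exists>D. countable D \<and> D \<subseteq> tangent x \<and>
      (\<forall>v\<in>tangent x. \<forall>e>0. \<exists>w\<in>D. tdist x v w < e))"

definition vfield :: "('a::metric_space \<Rightarrow> 'a tvec set) \<Rightarrow> bool" where
  "vfield A \<longleftrightarrow> (\<forall>x. A x \<subseteq> tangent x)"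

definition monotone_vf :: "('a::metric_space \<Rightarrow> 'a tvec set) \<Rightarrow> bool" where
  "monotone_vf A \<longleftrightarrow> (\<forall>x y. \<forall>u\<in>A x. \<forall>v\<in>A y.
      tinner x u (tlog x y) \<le> - tinner y v (tlog y x))"

definition strongly_monotone_vf :: "('a::metric_space \<Rightarrow> 'a tvec set) \<Rightarrow> real \<Rightarrow> bool" where
  "strongly_monotone_vf A \<alpha> \<longleftrightarrow> \<alpha> > 0 \<and> (\<forall>x y. \<forall>u\<in>A x. \<forall>v\<in>A y.
      tinner x u (tlog x y) \<le> - tinner y v (tlog y x) - \<alpha> * (dist x y)\<^sup>2)"

definition resolvent :: "('a::metric_space \<Rightarrow> 'a tvec set) \<Rightarrow> real \<Rightarrow> 'a \<Rightarrow> 'a" where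
  "resolvent A lam x = (THE z. tmem z (tscale (1 / lam) (tlog z x)) (A z))"

definition surjectivity_cond :: "('a::metric_space \<Rightarrow> 'a tvec set) \<Rightarrow> bool" where
  "surjectivity_cond A \<longleftrightarrow> (\<forall>lam>0. \<forall>x. \<exists>z. tmem z (tscale (1 / lam) (tlog z x)) (A z))"

definition yosida :: "('a::metric_space \<Rightarrow> 'a tvec set) \<Rightarrow> real \<Rightarrow> 'a \<Rightarrow> 'a tvec" where
  "yosida A lam x = tscale (1 / lam) (tlog (resolvent A lam x) x)"

text \<open>Borel measurability into the separable metric space T_x X (tested via the
  distance functions to all points).\<close>
definition tmeasurable :: "'e measure \<Rightarrow> 'a::metric_space \<Rightarrow> ('e \<Rightarrow> 'a tvec) \<Rightarrow> bool" where
  "tmeasurable M x \<phi> \<longleftrightarrow> (\<forall>s\<in>space M. \<phi> s \<in> tangent x) \<and>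
      (\<forall>v\<in>tangent x. (\<lambda>s. tdist x (\<phi> s) v) \<in> borel_measurable M)"

definition tLp :: "nat \<Rightarrow> 'e measure \<Rightarrow> 'a::metric_space \<Rightarrow> ('e \<Rightarrow> 'a tvec) \<Rightarrow> bool" where
  "tLp p M x \<phi> \<longleftrightarrow> tmeasurable M x \<phi> \<and> integrable M (\<lambda>s. (tnorm x (\<phi> s)) ^ p)"

text \<open>b is the barycenter (integral) of phi: it minimises
  z \<mapsto> \<integral> (d^2(z,phi s) - d^2(phi s, y)) for the fixed base point y = 0_x.\<close>
definition tbarycenter :: "'e measure \<Rightarrow> 'a::metric_space \<Rightarrow> ('e \<Rightarrow> 'a tvec) \<Rightarrow> 'a tvec \<Rightarrow> bool" where
  "tbarycenter M x \<phi> b \<longleftrightarrow> b \<in> tangent x \<and> (\<forall>z\<in>tangent x.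
      (\<integral>s. (tdist x b (\<phi> s))\<^sup>2 - (tdist x (\<phi> s) (tzero x))\<^sup>2 \<partial>M)
      \<le> (\<integral>s. (tdist x z (\<phi> s))\<^sup>2 - (tdist x (\<phi> s) (tzero x))\<^sup>2 \<partial>M))"

definition selections :: "nat \<Rightarrow> 'e measure \<Rightarrow> ('e \<Rightarrow> 'a::metric_space \<Rightarrow> 'a tvec set) \<Rightarrow> 'a \<Rightarrow> ('e \<Rightarrow> 'a tvec) set" where
  "selections p M A x = {\<phi>. (\<forall>s\<in>space M. tmem x (\<phi> s) (A s x)) \<and> tLp p M x \<phi>}"

definition mean_field :: "'e measure \<Rightarrow> ('e \<Rightarrow> 'a::metric_space \<Rightarrow> 'a tvec set) \<Rightarrow> 'a \<Rightarrow> 'a tvec set" where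
  "mean_field M A x = {b. \<exists>\<phi>\<in>selections 1 M A x. tbarycenter M x \<phi> b}"

definition zeros2 :: "'e measure \<Rightarrow> ('e \<Rightarrow> 'a::metric_space \<Rightarrow> 'a tvec set) \<Rightarrow> 'a set" where
  "zeros2 M A = {x. \<exists>\<phi>\<in>selections 2 M A x. tbarycenter M x \<phi> (tzero x)}"

definition random_monotone_vf :: "'e measure \<Rightarrow> ('e \<Rightarrow> 'a::metric_space \<Rightarrow> 'a tvec set) \<Rightarrow> bool" where
  "random_monotone_vf M A \<longleftrightarrow> (\<forall>s\<in>space M. vfield (A s) \<and> monotone_vf (A s) \<and> surjectivity_cond (A s)) \<and>
     (\<forall>x lam. lam > 0 \<longrightarrow> (\<lambda>s. resolvent (A s) lam x) \<in> borel_measurable M)"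

definition nat_filtration :: "'w measure \<Rightarrow> 'e measure \<Rightarrow> (nat \<Rightarrow> 'w \<Rightarrow> 'e) \<Rightarrow> nat \<Rightarrow> 'w measure" where
  "nat_filtration P M \<xi> n = sigma (space P)
     {\<xi> i -` B \<inter> space P | i B. i \<in> {1..n} \<and> B \<in> sets M}"

primrec ppa_iter :: "('e \<Rightarrow> 'a::metric_space \<Rightarrow> 'a tvec set) \<Rightarrow> 'a \<Rightarrow> (nat \<Rightarrow> real) \<Rightarrow> (nat \<Rightarrow> 'w \<Rightarrow> 'e) \<Rightarrow> nat \<Rightarrow> 'w \<Rightarrow> 'a" where
  "ppa_iter A x0 lam \<xi> 0 = (\<lambda>\<omega>. x0)"
| "ppa_iter A x0 lam \<xi> (Suc n) = (\<lambda>\<omega>. resolvent (A (\<xi> (Suc n) \<omega>)) (lam n) (ppa_iter A x0 lam \<xi> n \<omega>))"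

end

(*
The comparison inequality (resolvent_step) is monotonicity written out at x_{n+1} and xstar, with
D_n = d(x_n, xstar), d_n = d(x_n, x_{n+1}), f = |phistar|, g = g_xstar(phistar, log x_n):
  (1 + 2 lam_n alpha) D_{n+1}^2 <= D_n^2 - 2 lam_n g - d_n^2 + 2 lam_n f d_n.
Dropping the left-hand factor shows that D_n^2 plus the tail of c * sum lam_i^2 is a
supermartingale, which gives the tail bound by Ville's inequality. For the rate, alpha depends on
the same sample as x_{n+1}, so (abar - alpha) D_{n+1}^2 is compared with the independent product
(abar - alpha) D_n^2 of mean zero; the error is absorbed by d_n^2 with a weight
k = max 1 (2 abar), and E (alpha - abar)^2 <= abar - abar^2. The resulting recursion propagates
E D_n^2 <= u / (n + 2) once n + 2 >= 4 / abar^2; earlier terms are bounded by b + c Lambda.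
*)
theory Submission
  imports Defs
begin

text \<open>The constants of the rate are tight enough to shape the argument. With
  \<open>h = 1 / m\<close> and step size \<open>h / a\<close>, the identity \<open>(1 + 2 * h) * (u
  * h / (1 + h)) = u * h + h^2 * (u / (1 + h))\<close> shows that \<open>u / m\<close> propagates to
  \<open>u / (m + 1)\<close> as soon as the noise, which carries the factor
  \<open>h^2 / a^2\<close>, stays below \<open>a^2 * u / (1 + h)\<close>. The entry
  \<open>4 * \<sigma> + 2 * c\<close> of u controls \<sigma>, but leaves c of order u, too large for
  small a. The other entry repairs this: \<Lambda> is at least \<open>5 / 8 / a^2\<close>, so c is
  at most \<open>2 / 5 * a^4 * u\<close>. The weight k trades a Young term with factor
  \<open>1 / k\<close> against a residue \<open>(k - 1) * d_n^2\<close>; k = 1 leaves no such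
  residue and serves small a, while a near 1 needs a larger k. On the geometric side a tangent
  vector is a Cauchy sequence in a cone without linear structure. Inner products with the direction
  of q are therefore treated as minus the derivative of the distance to q, which makes them
  Lipschitz in the other argument and lets them pass to the completion.\<close>

section \<open>Comparison angles and the law of cosines\<close>

text \<open>The cosine of \<open>cangle\<close>. With it the monotonicity arguments stay algebraic,
  and \<open>arccos\<close> enters only when the limit \<open>aangle\<close> is identified.\<close>

definition ccos :: "'a::metric_space \<Rightarrow> 'a \<Rightarrow> 'a \<Rightarrow> real" where
  "ccos x p q = ((dist x p)\<^sup>2 + (dist x q)\<^sup>2 - (dist p q)\<^sup>2) / (2 * dist x p * dist x q)"

lemma ccos_commute: "ccos x p q = ccos x q p"
  unfolding ccos_def by (simp add: dist_commute algebra_simps)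

lemma ccos_bounds:
  fixes x p q :: "'a::metric_space"
  assumes "p \<noteq> x" "q \<noteq> x"
  shows "- 1 \<le> ccos x p q" "ccos x p q \<le> 1"
proof -
  have pos: "2 * dist x p * dist x q > 0" using assms by simp
  have "(dist x p - dist x q)\<^sup>2 \<le> (dist p q)\<^sup>2"
    using dist_triangle[of x p q] dist_triangle[of x q p]
    by (intro abs_le_square_iff[THEN iffD1]) (simp add: dist_commute abs_le_iff)
  then show "ccos x p q \<le> 1"
    unfolding ccos_def using pos by (simp add: divide_le_eq power2_eq_square algebra_simps)
  have "(dist p q)\<^sup>2 \<le> (dist x p + dist x q)\<^sup>2"
    using dist_triangle[of p q x] by (intro power_mono) (simp_all add: dist_commute)
  then show "- 1 \<le> ccos x p q"
    unfolding ccos_def using pos by (simp add: le_divide_eq power2_eq_square algebra_simps)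
qed

lemma cos_law:
  fixes x p q :: "'a::metric_space"
  assumes "p \<noteq> x" "q \<noteq> x"
  shows "(dist p q)\<^sup>2 = (dist x p)\<^sup>2 + (dist x q)\<^sup>2 - 2 * dist x p * dist x q * ccos x p q"
  unfolding ccos_def using assms by simp

section \<open>Geodesics and Aleksandrov angles in Hadamard spaces\<close>

locale hadamard_space =
  fixes T :: "'a::complete_space itself"
  assumes had: "hadamard T"
begin

text \<open>Multiplying by the length clears the division in \<open>t = s / l\<close>, so that the
  degenerate geodesic l = 0 is covered as well.\<close>

lemma cat0_ineq:
  fixes q :: 'a
  assumes "geodesic_seg \<gamma> l" "0 \<le> s" "s \<le> l"
  shows "l * (dist (\<gamma> s) q)\<^sup>2 \<le> (l - s) * (dist (\<gamma> 0) q)\<^sup>2 + s * (dist (\<gamma> l) q)\<^sup>2 - s * (l - s) * l"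
proof (cases "l = 0")
  case True
  then show ?thesis using assms by simp
next
  case False
  then have l: "l > 0" using assms by simp
  have "CAT0 T" using had by (simp add: hadamard_def)
  moreover have "0 \<le> s / l" "s / l \<le> 1" using assms l by (auto simp: divide_le_eq)
  ultimately have *: "(dist (\<gamma> (s / l * l)) q)\<^sup>2 \<le> (1 - s / l) * (dist (\<gamma> 0) q)\<^sup>2 + s / l * (dist (\<gamma> l) q)\<^sup>2
         - s / l * (1 - s / l) * (dist (\<gamma> 0) (\<gamma> l))\<^sup>2"
    using assms(1) unfolding CAT0_def by blast
  have "dist (\<gamma> 0) (\<gamma> l) = l" using assms(1) l unfolding geodesic_seg_def by auto
  then have "l * (dist (\<gamma> s) q)\<^sup>2 \<le> l * ((1 - s / l) * (dist (\<gamma> 0) q)\<^sup>2 + s / l * (dist (\<gamma> l) q)\<^sup>2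
         - s / l * (1 - s / l) * l\<^sup>2)"
    using * l by (intro mult_left_mono) auto
  also have "\<dots> = (l - s) * (dist (\<gamma> 0) q)\<^sup>2 + s * (dist (\<gamma> l) q)\<^sup>2 - s * (l - s) * l"
    using l by (simp add: field_simps power2_eq_square)
  finally show ?thesis .
qed

text \<open>The description in \<open>gpt\<close> denotes only once its point is unique. Observed
  from a rival point p, the right-hand side of \<open>cat0_ineq\<close> vanishes, which forces p to
  be the point of the geodesic.\<close>

lemma gpt_geodesic:
  fixes x a :: 'a
  assumes g: "geodesic_seg \<gamma> l" "\<gamma> 0 = x" "\<gamma> l = a" and s: "0 \<le> s" "s \<le> l"
  shows "gpt x a s = \<gamma> s"
  unfolding gpt_def
proof (rule the_equality)
  have d: "\<And>s t. 0 \<le> s \<Longrightarrow> s \<le> l \<Longrightarrow> 0 \<le> t \<Longrightarrow> t \<le> l \<Longrightarrow> dist (\<gamma> s) (\<gamma> t) = \<bar>s - t\<bar>"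
    using g(1) unfolding geodesic_seg_def by auto
  have xa: "dist x a = l" using d[of 0 l] g s by simp
  show "dist x (\<gamma> s) = s \<and> dist (\<gamma> s) a = dist x a - s"
    using d[of 0 s] d[of s l] g s xa by simp
  fix p assume p: "dist x p = s \<and> dist p a = dist x a - s"
  have "l * (dist (\<gamma> s) p)\<^sup>2 \<le> (l - s) * s\<^sup>2 + s * (l - s)\<^sup>2 - s * (l - s) * l"
    using cat0_ineq[OF g(1) s, of p] g p xa by (simp add: dist_commute)
  also have "\<dots> = 0" by algebra
  finally have "l = 0 \<or> p = \<gamma> s"
    using s by (auto simp: mult_le_0_iff)
  moreover have "p = \<gamma> s" if "l = 0" using that s p g by auto
  ultimately show "p = \<gamma> s" by blast
qed

lemma geodesic_ex:
  fixes x a :: 'a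
  obtains \<gamma> where "geodesic_seg \<gamma> (dist x a)" "\<gamma> 0 = x" "\<gamma> (dist x a) = a"
    "\<And>s. 0 \<le> s \<Longrightarrow> s \<le> dist x a \<Longrightarrow> gpt x a s = \<gamma> s"
proof -
  obtain \<gamma> where g: "geodesic_seg \<gamma> (dist x a)" "\<gamma> 0 = x" "\<gamma> (dist x a) = a"
    using had unfolding hadamard_def geodesic_space_def by blast
  then show ?thesis using that gpt_geodesic[OF g] by blast
qed

lemma gpt_0 [simp]: "gpt x a 0 = (x::'a)"
  by (rule geodesic_ex[of x a]) simp

lemma gpt_end [simp]: "gpt x a (dist x a) = (a::'a)"
  by (rule geodesic_ex[of x a]) simp

lemma dist_gpt:
  fixes x a :: 'a
  assumes "0 \<le> s" "s \<le> dist x a" "0 \<le> t" "t \<le> dist x a"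
  shows "dist (gpt x a s) (gpt x a t) = \<bar>s - t\<bar>"
  by (rule geodesic_ex[of x a]) (use assms in \<open>auto simp: geodesic_seg_def\<close>)

lemma dist_gpt_left:
  fixes x a :: 'a
  assumes "0 \<le> s" "s \<le> dist x a"
  shows "dist x (gpt x a s) = s"
  using dist_gpt[of 0 x a s] assms by simp

lemma gpt_neq:
  fixes x a :: 'a
  assumes "0 < s" "s \<le> dist x a"
  shows "gpt x a s \<noteq> x"
  using dist_gpt_left[of s x a] assms by auto

lemma gpt_gpt:
  fixes x a :: 'a
  assumes "0 \<le> t" "t \<le> s" "s \<le> dist x a"
  shows "gpt x (gpt x a s) t = gpt x a t"
proof (rule geodesic_ex[of x a])
  fix \<gamma> assume g: "geodesic_seg \<gamma> (dist x a)" "\<gamma> 0 = x"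
    and *: "\<And>s. 0 \<le> s \<Longrightarrow> s \<le> dist x a \<Longrightarrow> gpt x a s = \<gamma> s"
  have "geodesic_seg \<gamma> s" using g(1) assms unfolding geodesic_seg_def by auto
  then have "gpt x (gpt x a s) t = \<gamma> t"
    by (rule gpt_geodesic) (use g assms * in auto)
  then show ?thesis using * assms by simp
qed

text \<open>The CAT(0) inequality along the geodesic from x to a, observed from q, is after division
  by \<open>2 * l * d * s\<close> a comparison of the two cosines.\<close>

lemma ccos_gpt_le:
  fixes x a q :: 'a
  assumes "0 < s" "s \<le> dist x a" "q \<noteq> x"
  shows "ccos x a q \<le> ccos x (gpt x a s) q"
proof (rule geodesic_ex[of x a])
  fix \<gamma> assume g: "geodesic_seg \<gamma> (dist x a)" "\<gamma> 0 = x" "\<gamma> (dist x a) = a"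
    and *: "\<And>s. 0 \<le> s \<Longrightarrow> s \<le> dist x a \<Longrightarrow> gpt x a s = \<gamma> s"
  define l d where "l = dist x a" and "d = dist x q"
  have l: "l > 0" using assms l_def by linarith
  have d: "d > 0" using assms d_def by simp
  have "l * (dist (gpt x a s) q)\<^sup>2 \<le> (l - s) * d\<^sup>2 + s * (dist a q)\<^sup>2 - s * (l - s) * l"
    using cat0_ineq[OF g(1), of s q] assms g * by (simp add: l_def d_def)
  then have "s * (l\<^sup>2 + d\<^sup>2 - (dist a q)\<^sup>2) \<le> l * (s\<^sup>2 + d\<^sup>2 - (dist (gpt x a s) q)\<^sup>2)"
    by (simp add: algebra_simps power2_eq_square)
  then have "s * (l\<^sup>2 + d\<^sup>2 - (dist a q)\<^sup>2) / (2 * l * d * s) \<le> l * (s\<^sup>2 + d\<^sup>2 - (dist (gpt x a s) q)\<^sup>2) / (2 * l * d * s)"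
    using l d assms by (intro divide_right_mono) auto
  then show ?thesis
    unfolding ccos_def using dist_gpt_left[of s x a] assms l d
    by (simp add: l_def[symmetric] d_def[symmetric] mult_ac)
qed

lemma ccos_gpt_antimono:
  fixes x a b :: 'a
  assumes "0 < s'" "s' \<le> s" "s \<le> dist x a" "0 < t'" "t' \<le> t" "t \<le> dist x b"
  shows "ccos x (gpt x a s) (gpt x b t) \<le> ccos x (gpt x a s') (gpt x b t')"
proof -
  have "ccos x (gpt x a s) (gpt x b t) \<le> ccos x (gpt x a s') (gpt x b t)"
    using ccos_gpt_le[of s' x "gpt x a s" "gpt x b t"] gpt_gpt[of s' s x a] assms
      gpt_neq[of t x b] dist_gpt_left[of s x a] by simp
  also have "\<dots> \<le> ccos x (gpt x a s') (gpt x b t')"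
    using ccos_gpt_le[of t' x "gpt x b t" "gpt x a s'"] gpt_gpt[of t' t x b] assms
      gpt_neq[of s' x a] dist_gpt_left[of t x b] by (simp add: ccos_commute)
  finally show ?thesis .
qed

text \<open>In a CAT(0) space comparison angles decrease towards the vertex, so the Aleksandrov
  angle is their infimum.\<close>

lemma tendsto_ccos:
  fixes x a b :: 'a
  assumes "a \<noteq> x" "b \<noteq> x"
  shows "((\<lambda>(s,t). ccos x (gpt x a s) (gpt x b t)) \<longlongrightarrow> cos (aangle x a b))
      (at_right 0 \<times>\<^sub>F at_right 0)"
    and "\<lbrakk>0 < s; s \<le> dist x a; 0 < t; t \<le> dist x b\<rbrakk> \<Longrightarrow>
      ccos x (gpt x a s) (gpt x b t) \<le> cos (aangle x a b)"
proof -
  define f where "f = (\<lambda>(s,t). ccos x (gpt x a s) (gpt x b t))"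
  define S where "S = {0<..dist x a} \<times> {0<..dist x b}"
  \<comment> \<open>Monotonicity makes the limit a supremum over the whole rectangle, so the bound
    in the second claim needs no separate argument.\<close>
  define L where "L = Sup (f ` S)"
  let ?F = "at_right (0::real) \<times>\<^sub>F at_right (0::real)"
  have ne: "?F \<noteq> bot" by (simp add: prod_filter_eq_bot)
  have la: "dist x a > 0" "dist x b > 0" using assms by auto
  have bd: "- 1 \<le> f z \<and> f z \<le> 1" if "z \<in> S" for z
    using that gpt_neq ccos_bounds[of "gpt x a (fst z)" x "gpt x b (snd z)"]
    by (auto simp: S_def f_def)
  have bdd: "bdd_above (f ` S)" using bd by (auto intro!: bdd_aboveI[of _ 1])
  have le: "f z \<le> L" if "z \<in> S" for z
    unfolding L_def using bdd that by (intro cSup_upper) auto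
  have S0: "S \<noteq> {}" using la by (auto simp: S_def)
  have ev: "eventually (\<lambda>z. 0 < fst z \<and> fst z \<le> s \<and> 0 < snd z \<and> snd z \<le> t) ?F"
    if "s > 0" "t > 0" for s t :: real
    unfolding eventually_prod_filter
    using that by (intro exI[of _ "\<lambda>r. 0 < r \<and> r \<le> s"] exI[of _ "\<lambda>r. 0 < r \<and> r \<le> t"])
      (auto simp: eventually_at_right_field intro: exI[of _ s] exI[of _ t])
  have lim: "(f \<longlongrightarrow> L) ?F"
  proof (rule order_tendstoI)
    fix y assume "y < L"
    then obtain z where z: "z \<in> S" "y < f z"
      unfolding L_def using less_cSup_iff[of "f ` S" y] bdd S0 by auto
    have "eventually (\<lambda>w. 0 < fst w \<and> fst w \<le> fst z \<and> 0 < snd w \<and> snd w \<le> snd z) ?F"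
      by (rule ev) (use z in \<open>auto simp: S_def\<close>)
    then show "eventually (\<lambda>w. y < f w) ?F"
    proof (rule eventually_mono)
      fix w :: "real \<times> real"
      assume "0 < fst w \<and> fst w \<le> fst z \<and> 0 < snd w \<and> snd w \<le> snd z"
      then have "f z \<le> f w" unfolding f_def
        using ccos_gpt_antimono[of "fst w" "fst z" x a "snd w" "snd z" b] z(1)
        by (auto simp: S_def split: prod.splits)
      then show "y < f w" using z by simp
    qed
  next
    fix y assume "L < y"
    show "eventually (\<lambda>w. f w < y) ?F"
      by (rule eventually_mono[OF ev[OF la]]) (use le \<open>L < y\<close> in \<open>force simp: S_def\<close>)
  qed
  have L1: "L \<le> 1" unfolding L_def using S0 bd by (intro cSup_least) auto
  have L2: "- 1 \<le> L" using S0 bd le by (meson ex_in_conv order_trans)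
  have evS: "eventually (\<lambda>w. w \<in> S) ?F"
    by (rule eventually_mono[OF ev[OF la]]) (auto simp: S_def)
  have "((\<lambda>w. arccos (f w)) \<longlongrightarrow> arccos L) ?F"
    by (rule continuous_on_tendsto_compose[OF continuous_on_arccos' lim])
      (use L1 L2 bd in \<open>auto intro: eventually_mono[OF evS]\<close>)
  \<comment> \<open>\<open>aangle\<close> is a \<open>Lim\<close>, which is determined only after
    convergence along a nontrivial filter is known.\<close>
  then have "Lim ?F (\<lambda>w. arccos (f w)) = arccos L"
    using ne by (intro tendsto_Lim)
  moreover have "(\<lambda>w. arccos (f w)) = (\<lambda>(s,t). cangle x (gpt x a s) (gpt x b t))"
    by (auto simp: f_def cangle_def ccos_def)
  ultimately have "cos (aangle x a b) = L"
    using L1 L2 by (simp add: aangle_def)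
  then show "((\<lambda>(s,t). ccos x (gpt x a s) (gpt x b t)) \<longlongrightarrow> cos (aangle x a b)) ?F"
    "\<lbrakk>0 < s; s \<le> dist x a; 0 < t; t \<le> dist x b\<rbrakk> \<Longrightarrow>
      ccos x (gpt x a s) (gpt x b t) \<le> cos (aangle x a b)"
    using lim le[of "(s,t)"] by (auto simp: f_def S_def)
qed

lemma ccos_le_cos_aangle:
  fixes x a b :: 'a
  assumes "a \<noteq> x" "b \<noteq> x"
  shows "ccos x a b \<le> cos (aangle x a b)"
  using tendsto_ccos(2)[OF assms, of "dist x a" "dist x b"] assms by simp

lemma cos_aangle_approx:
  fixes x a b :: 'a
  assumes "a \<noteq> x" "b \<noteq> x" "e > 0"
  obtains s t where "0 < s" "s \<le> dist x a" "0 < t" "t \<le> dist x b"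
    "ccos x (gpt x a s) (gpt x b t) > cos (aangle x a b) - e"
proof -
  let ?F = "at_right (0::real) \<times>\<^sub>F at_right (0::real)"
  have "eventually (\<lambda>z. cos (aangle x a b) - e < (\<lambda>(s,t). ccos x (gpt x a s) (gpt x b t)) z) ?F"
    by (rule order_tendstoD(1)[OF tendsto_ccos(1)[OF assms(1,2)]]) (use assms in simp)
  moreover have "eventually (\<lambda>z. (0 < fst z \<and> fst z \<le> dist x a) \<and> (0 < snd z \<and> snd z \<le> dist x b)) ?F"
    unfolding eventually_prod_filter
    using assms by (intro exI[of _ "\<lambda>r. 0 < r \<and> r \<le> dist x a"] exI[of _ "\<lambda>r. 0 < r \<and> r \<le> dist x b"])
      (auto simp: eventually_at_right_field intro: exI[of _ "dist x a"] exI[of _ "dist x b"])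
  ultimately have "eventually (\<lambda>z. cos (aangle x a b) - e < (\<lambda>(s,t). ccos x (gpt x a s) (gpt x b t)) z
     \<and> (0 < fst z \<and> fst z \<le> dist x a) \<and> (0 < snd z \<and> snd z \<le> dist x b)) ?F"
    by (rule eventually_conj)
  moreover have "?F \<noteq> bot" by (simp add: prod_filter_eq_bot)
  ultimately obtain z where "cos (aangle x a b) - e < (\<lambda>(s,t). ccos x (gpt x a s) (gpt x b t)) z
     \<and> (0 < fst z \<and> fst z \<le> dist x a) \<and> (0 < snd z \<and> snd z \<le> dist x b)"
    using eventually_happens' by blast
  then show ?thesis using that[of "fst z" "snd z"] by (auto split: prod.splits)
qed

text \<open>The defining limit treats its two arguments in a fixed order. Its cosine is approximated
  from below by \<open>ccos\<close>, which is symmetric and bounded by the cosine in either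
  order.\<close>

lemma cos_aangle_commute:
  fixes x a b :: 'a
  assumes "a \<noteq> x" "b \<noteq> x"
  shows "cos (aangle x a b) = cos (aangle x b a)"
proof -
  have *: "cos (aangle x a b) \<le> cos (aangle x b a)" if "a \<noteq> x" "b \<noteq> x" for a b :: 'a
  proof (rule field_le_epsilon)
    fix e :: real assume "e > 0"
    then obtain s t where st: "0 < s" "s \<le> dist x a" "0 < t" "t \<le> dist x b"
      "ccos x (gpt x a s) (gpt x b t) > cos (aangle x a b) - e"
      using cos_aangle_approx \<open>a \<noteq> x\<close> \<open>b \<noteq> x\<close> by blast
    then have "ccos x (gpt x a s) (gpt x b t) \<le> cos (aangle x b a)"
      using tendsto_ccos(2)[of b x a t s] that by (subst ccos_commute) auto
    then show "cos (aangle x a b) \<le> cos (aangle x b a) + e" using st by linarith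
  qed
  show ?thesis using *[of a b] *[of b a] assms by simp
qed

end

section \<open>The tangent cone as a blow-up of the space\<close>

lemma cnorm_nonneg: "fst v \<ge> 0 \<Longrightarrow> cnorm x v \<ge> 0"
  by (simp add: cnorm_def)

text \<open>An exponential map at scale h: the point reached from x by following v for time h. It is
  meaningful only while \<open>fst v * h\<close> does not exceed the length of the geodesic to
  \<open>snd v\<close>, hence the estimates that hold only eventually as h tends to 0 from the
  right.\<close>

definition cone_pt :: "'a::metric_space \<Rightarrow> real \<times> 'a \<Rightarrow> real \<Rightarrow> 'a" where
  "cone_pt x v h = (if snd v = x then x else gpt x (snd v) (fst v * h))"

lemma filterlim_scale_at_right:
  assumes "r > (0::real)"
  shows "filterlim (\<lambda>h. r * h) (at_right 0) (at_right 0)"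
  unfolding filterlim_at
  using assms by (auto intro!: tendsto_eq_intros simp: eventually_at_right_less
    intro: eventually_mono[OF eventually_at_right_less])

context hadamard_space
begin

lemma cinner_commute: "cinner x u v = cinner x v (u :: real \<times> 'a)"
  by (simp add: cinner_def cos_aangle_commute)

lemma eventually_scaled_le:
  fixes t l :: real
  assumes "l > 0"
  shows "eventually (\<lambda>h. h > 0 \<and> t * h \<le> l) (at_right 0)"
proof (cases "t > 0")
  case True
  then show ?thesis unfolding eventually_at_right_field
    using assms by (intro exI[of _ "l / t"]) (auto simp: less_divide_eq mult.commute)
next
  case False
  then have "t * h \<le> l" if "h > 0" for h
    using that assms by (meson dual_order.trans less_eq_real_def mult_le_0_iff not_le)
  then show ?thesis unfolding eventually_at_right_field by (intro exI[of _ 1]) auto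
qed

lemma eventually_dist_cone_pt:
  fixes x :: 'a
  assumes "fst v \<ge> 0"
  shows "eventually (\<lambda>h. h > 0 \<and> dist x (cone_pt x v h) = cnorm x v * h) (at_right 0)"
proof (cases "snd v = x")
  case True
  then show ?thesis by (simp add: cone_pt_def cnorm_def eventually_at_right_less)
next
  case False
  show ?thesis
    by (rule eventually_mono[OF eventually_scaled_le[of "dist x (snd v)" "fst v"]])
      (use False assms in \<open>auto simp: cone_pt_def cnorm_def dist_gpt_left\<close>)
qed

lemma cone_pt_zero: "cnorm x v = 0 \<Longrightarrow> cone_pt x v h = (x::'a)"
  by (auto simp: cone_pt_def cnorm_def split: if_splits)

lemma cinner_zero: "cnorm x v = 0 \<Longrightarrow> cinner x v w = 0" "cnorm x w = 0 \<Longrightarrow> cinner x v w = 0"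
  for x :: 'a
  by (auto simp: cinner_def cnorm_def split: if_splits)

text \<open>The cone metric is the blow-up of the metric at the vertex, so the triangle inequality
  and the comparison of inner products below need no triangle inequality for angles.\<close>

lemma tendsto_cdist:
  fixes x :: 'a
  assumes u: "fst u \<ge> 0" and w: "fst w \<ge> 0"
  shows "((\<lambda>h. dist (cone_pt x u h) (cone_pt x w h) / h) \<longlongrightarrow> cdist x u w) (at_right 0)"
proof (cases "cnorm x u = 0 \<or> cnorm x w = 0")
  case True
  then show ?thesis
  proof
    assume 0: "cnorm x u = 0"
    have "eventually (\<lambda>h. dist (cone_pt x u h) (cone_pt x w h) / h = cdist x u w) (at_right 0)"
      by (rule eventually_mono[OF eventually_dist_cone_pt[OF w, of x]])
        (use 0 cnorm_nonneg[OF w, of x] in \<open>auto simp: cone_pt_zero cdist_def cinner_zero\<close>)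
    then show ?thesis by (rule tendsto_eventually)
  next
    assume 0: "cnorm x w = 0"
    have "eventually (\<lambda>h. dist (cone_pt x u h) (cone_pt x w h) / h = cdist x u w) (at_right 0)"
      by (rule eventually_mono[OF eventually_dist_cone_pt[OF u, of x]])
        (use 0 cnorm_nonneg[OF u, of x] in \<open>auto simp: cone_pt_zero cdist_def cinner_zero dist_commute\<close>)
    then show ?thesis by (rule tendsto_eventually)
  qed
next
  case False
  obtain t a where ua: "u = (t,a)" by (cases u)
  obtain s b where wb: "w = (s,b)" by (cases w)
  have ax: "a \<noteq> x" and bx: "b \<noteq> x" and t: "t > 0" and s: "s > 0"
    using False u w by (auto simp: ua wb cnorm_def split: if_splits)
  define f where "f = (\<lambda>(s,t). ccos x (gpt x a s) (gpt x b t))"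
  have "filterlim (\<lambda>h. (t * h, s * h)) (at_right 0 \<times>\<^sub>F at_right 0) (at_right 0)"
    by (intro filterlim_Pair filterlim_scale_at_right t s)
  then have f: "((\<lambda>h. f (t * h, s * h)) \<longlongrightarrow> cos (aangle x a b)) (at_right 0)"
    using filterlim_compose[OF tendsto_ccos(1)[OF ax bx]] unfolding f_def by blast
  have "((\<lambda>h. sqrt (t\<^sup>2 + s\<^sup>2 - 2 * t * s * f (t * h, s * h))) \<longlongrightarrow> cdist x u w) (at_right 0)"
    by (rule tendsto_eq_intros refl f)+
      (simp add: ua wb cdist_def cnorm_def cinner_def ax bx)
  moreover have "eventually (\<lambda>h. sqrt (t\<^sup>2 + s\<^sup>2 - 2 * t * s * f (t * h, s * h)) =
     dist (cone_pt x u h) (cone_pt x w h) / h) (at_right 0)"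
  proof -
    have "eventually (\<lambda>h. (h > 0 \<and> t * h \<le> dist x a) \<and> (h > 0 \<and> s * h \<le> dist x b)) (at_right 0)"
      by (intro eventually_conj eventually_scaled_le) (use ax bx in auto)
    then show ?thesis
    proof (rule eventually_mono)
      fix h assume h: "(h > 0 \<and> t * h \<le> dist x a) \<and> (h > 0 \<and> s * h \<le> dist x b)"
      then have pos: "0 < t * h" "0 < s * h" using t s by auto
      have "(dist (cone_pt x u h) (cone_pt x w h))\<^sup>2 =
        (t * h)\<^sup>2 + (s * h)\<^sup>2 - 2 * (t * h) * (s * h) * f (t * h, s * h)"
        using cos_law[of "gpt x a (t * h)" x "gpt x b (s * h)"] gpt_neq[of "t * h" x a]
          gpt_neq[of "s * h" x b] dist_gpt_left[of "t * h" x a] dist_gpt_left[of "s * h" x b] h pos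
        by (simp add: f_def cone_pt_def ua wb ax bx)
      also have "\<dots> = h\<^sup>2 * (t\<^sup>2 + s\<^sup>2 - 2 * t * s * f (t * h, s * h))"
        by (simp add: power2_eq_square algebra_simps)
      finally have "t\<^sup>2 + s\<^sup>2 - 2 * t * s * f (t * h, s * h) = (dist (cone_pt x u h) (cone_pt x w h) / h)\<^sup>2"
        using h by (simp add: power_divide)
      then show "sqrt (t\<^sup>2 + s\<^sup>2 - 2 * t * s * f (t * h, s * h)) =
        dist (cone_pt x u h) (cone_pt x w h) / h"
        using h by simp
    qed
  qed
  ultimately show ?thesis
    by (rule Lim_transform_eventually)
qed

lemma cdist_nonneg:
  fixes x :: 'a
  assumes "fst u \<ge> 0" "fst w \<ge> 0"
  shows "cdist x u w \<ge> 0"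
  using tendsto_cdist[OF assms, of x]
  by (rule tendsto_lowerbound) (auto intro: eventually_mono[OF eventually_at_right_less])

lemma cdist_commute: "cdist x u w = cdist x w (u :: real \<times> 'a)"
  by (simp add: cdist_def cinner_commute algebra_simps)

lemma cdist_triangle:
  fixes x :: 'a
  assumes "fst u \<ge> 0" "fst v \<ge> 0" "fst w \<ge> 0"
  shows "cdist x u w \<le> cdist x u v + cdist x v w"
proof (rule tendsto_le[OF _ _ tendsto_cdist])
  show "((\<lambda>h. dist (cone_pt x u h) (cone_pt x v h) / h + dist (cone_pt x v h) (cone_pt x w h) / h)
    \<longlongrightarrow> cdist x u v + cdist x v w) (at_right 0)"
    by (intro tendsto_add tendsto_cdist assms)
  have "dist (cone_pt x u h) (cone_pt x w h) / h \<le>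
      dist (cone_pt x u h) (cone_pt x v h) / h + dist (cone_pt x v h) (cone_pt x w h) / h"
    if "h > 0" for h
    using that by (simp add: add_divide_distrib[symmetric] divide_le_cancel dist_triangle)
  then show "eventually (\<lambda>h. dist (cone_pt x u h) (cone_pt x w h) / h \<le>
      dist (cone_pt x u h) (cone_pt x v h) / h + dist (cone_pt x v h) (cone_pt x w h) / h) (at_right 0)"
    by (auto intro: eventually_mono[OF eventually_at_right_less])
qed (use assms in auto)

text \<open>The angle is a limit in which both sides shrink, while here q stays fixed. Monotonicity
  of comparison angles gives the upper bound at full distance; the lower bound goes through an
  intermediate point \<open>gpt x q t0\<close> and the triangle inequality.\<close>

lemma first_variation:
  fixes x q :: 'a
  assumes v: "fst v \<ge> 0" and q: "q \<noteq> x"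
  shows "((\<lambda>h. (dist x q - dist (cone_pt x v h) q) / h) \<longlongrightarrow> cinner x v (1, q)) (at_right 0)"
proof (cases "cnorm x v = 0")
  case True
  then show ?thesis by (simp add: cone_pt_zero cinner_zero)
next
  case False
  obtain t a where va: "v = (t,a)" by (cases v)
  have ax: "a \<noteq> x" and t: "t > 0"
    using False v by (auto simp: va cnorm_def split: if_splits)
  define L where "L = cos (aangle x a q)"
  define l where "l = dist x q"
  have l: "l > 0" using q l_def by simp
  have upper: "(l - dist (gpt x a h) q) / h \<le> L" if h: "0 < h" "h \<le> dist x a" "h \<le> l" for h
  proof -
    have "ccos x (gpt x a h) (gpt x q l) \<le> L"
      unfolding L_def using tendsto_ccos(2)[OF ax q, of h l] h l by (simp add: l_def)
    then have c: "ccos x (gpt x a h) q \<le> L" by (simp add: l_def)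
    \<comment> \<open>Completing the square is harmless because \<open>L^2 <= 1\<close>.\<close>
    have "(l - h * L)\<^sup>2 \<le> l\<^sup>2 + h\<^sup>2 - 2 * h * l * L"
      using mult_left_mono[of "L\<^sup>2" 1 "h\<^sup>2"]
      by (simp add: power2_eq_square algebra_simps L_def abs_square_le_1[unfolded power2_eq_square])
    also have "\<dots> \<le> (dist (gpt x a h) q)\<^sup>2"
      using cos_law[of "gpt x a h" x q] gpt_neq[of h x a] dist_gpt_left[of h x a] h q l c
      by (simp add: l_def[symmetric] mult_ac)
    finally have "l - h * L \<le> dist (gpt x a h) q"
      by (rule power2_le_imp_le) simp
    then show ?thesis using h by (simp add: divide_le_eq mult_ac)
  qed
  have lower: "\<exists>h0>0. \<forall>h. 0 < h \<and> h \<le> h0 \<longrightarrow> L - 2 * e \<le> (l - dist (gpt x a h) q) / h" if e: "e > 0" for e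
  proof -
    obtain s0 t0 where st: "0 < s0" "s0 \<le> dist x a" "0 < t0" "t0 \<le> dist x q"
      "ccos x (gpt x a s0) (gpt x q t0) > L - e"
      unfolding L_def using cos_aangle_approx[OF ax q e] by blast
    \<comment> \<open>The restriction \<open>h <= 2 * t0 * e\<close> turns the term h^2 into at most
      \<open>2 * h * t0 * e\<close>, a second loss of e in the cosine.\<close>
    have "L - 2 * e \<le> (l - dist (gpt x a h) q) / h" if h: "0 < h" "h \<le> min s0 (2 * t0 * e)" for h
    proof -
      let ?d = "dist (gpt x a h) (gpt x q t0)"
      have c: "L - e \<le> ccos x (gpt x a h) (gpt x q t0)"
        using ccos_gpt_antimono[of h s0 x a t0 t0 q] st h by linarith
      have "?d\<^sup>2 = h\<^sup>2 + t0\<^sup>2 - 2 * h * t0 * ccos x (gpt x a h) (gpt x q t0)"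
        using cos_law[of "gpt x a h" x "gpt x q t0"] gpt_neq[of h x a] gpt_neq[of t0 x q]
          dist_gpt_left[of h x a] dist_gpt_left[of t0 x q] h st by simp
      also have "\<dots> \<le> h\<^sup>2 + t0\<^sup>2 - 2 * h * t0 * (L - e)"
        using c h st by simp
      also have "\<dots> \<le> t0\<^sup>2 - 2 * h * t0 * (L - 2 * e)"
        using h mult_left_mono[of h "2 * t0 * e" h] by (simp add: power2_eq_square algebra_simps)
      finally have le2: "?d\<^sup>2 \<le> t0\<^sup>2 - 2 * h * t0 * (L - 2 * e)" .
      also have "\<dots> \<le> (t0 - h * (L - 2 * e))\<^sup>2"
        by (simp add: power2_diff mult_ac)
      finally have le3: "?d\<^sup>2 \<le> (t0 - h * (L - 2 * e))\<^sup>2" .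
      \<comment> \<open>The sign is needed to take roots in \<open>le3\<close>; it comes from
        \<open>le2\<close>, whose left side is a square.\<close>
      have "t0 - h * (L - 2 * e) \<ge> 0"
      proof -
        have "0 \<le> ?d\<^sup>2" by simp
        also note le2
        finally have "t0\<^sup>2 - 2 * h * t0 * (L - 2 * e) \<ge> 0" .
        then have "t0 * (t0 - 2 * h * (L - 2 * e)) \<ge> 0" by (simp add: power2_eq_square algebra_simps)
        then have "t0 - 2 * h * (L - 2 * e) \<ge> 0" using st by (simp add: zero_le_mult_iff)
        then show ?thesis using st by linarith
      qed
      then have "?d \<le> t0 - h * (L - 2 * e)" using le3 by (rule power2_le_imp_le[rotated])
      moreover have "dist (gpt x a h) q \<le> ?d + (l - t0)"
        using dist_triangle[of "gpt x a h" q "gpt x q t0"] dist_gpt[of t0 x q l] st l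
        by (simp add: l_def)
      ultimately show ?thesis using h by (simp add: le_divide_eq algebra_simps)
    qed
    moreover have "min s0 (2 * t0 * e) > 0" using st e by simp
    ultimately show ?thesis by blast
  qed
  have G: "((\<lambda>h. (l - dist (gpt x a h) q) / h) \<longlongrightarrow> L) (at_right 0)"
  proof (rule order_tendstoI)
    fix y assume y: "y < L"
    obtain h0 where "h0 > 0" "\<forall>h. 0 < h \<and> h \<le> h0 \<longrightarrow> L - 2 * ((L - y) / 3) \<le> (l - dist (gpt x a h) q) / h"
      using lower[of "(L - y) / 3"] y by auto
    moreover have "y < L - 2 * ((L - y) / 3)" using y by (simp add: field_simps)
    ultimately show "eventually (\<lambda>h. y < (l - dist (gpt x a h) q) / h) (at_right 0)"
      unfolding eventually_at_right_field
      by (intro exI[of _ h0]) (meson less_le_trans less_imp_le)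
  next
    fix y assume y: "L < y"
    have "(l - dist (gpt x a h) q) / h < y" if "0 < h" "h < min l (dist x a)" for h
      using upper[of h] that y by simp
    then show "eventually (\<lambda>h. (l - dist (gpt x a h) q) / h < y) (at_right 0)"
      unfolding eventually_at_right_field using l ax by (intro exI[of _ "min l (dist x a)"]) auto
  qed
  have "((\<lambda>h. t * ((l - dist (gpt x a (t * h)) q) / (t * h))) \<longlongrightarrow> t * L) (at_right 0)"
    by (intro tendsto_mult tendsto_const filterlim_compose[OF G filterlim_scale_at_right[OF t]])
  then show ?thesis
    using t by (simp add: va cone_pt_def ax cinner_def q l_def L_def)
qed

lemma cinner_diff_le:
  fixes x :: 'a
  assumes "fst u \<ge> 0" "fst w \<ge> 0" "fst v \<ge> 0"
  shows "\<bar>cinner x u v - cinner x w v\<bar> \<le> cnorm x v * cdist x u w"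
proof (cases "snd v = x")
  case True
  then show ?thesis by (simp add: cinner_def cnorm_def)
next
  case False
  obtain r q where vq: "v = (r, q)" by (cases v)
  have q: "q \<noteq> x" using False vq by simp
  have *: "cinner x u (1, q) - cinner x w (1, q) \<le> cdist x u w" if "fst u \<ge> 0" "fst w \<ge> 0" for u w
  proof (rule tendsto_le[OF _ tendsto_cdist])
    show "((\<lambda>h. (dist x q - dist (cone_pt x u h) q) / h - (dist x q - dist (cone_pt x w h) q) / h)
      \<longlongrightarrow> cinner x u (1, q) - cinner x w (1, q)) (at_right 0)"
      by (intro tendsto_diff first_variation that q)
    have "(dist x q - dist (cone_pt x u h) q) / h - (dist x q - dist (cone_pt x w h) q) / h
        \<le> dist (cone_pt x u h) (cone_pt x w h) / h" if "h > 0" for h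
      using that dist_triangle[of "cone_pt x w h" q "cone_pt x u h"]
      by (simp add: diff_divide_distrib[symmetric] divide_le_cancel dist_commute)
    then show "eventually (\<lambda>h. (dist x q - dist (cone_pt x u h) q) / h - (dist x q - dist (cone_pt x w h) q) / h
        \<le> dist (cone_pt x u h) (cone_pt x w h) / h) (at_right 0)"
      by (auto intro: eventually_mono[OF eventually_at_right_less])
  qed (use that in auto)
  have sc: "cinner x u' v = r * cinner x u' (1, q)" for u'
    by (simp add: cinner_def vq)
  have "\<bar>cinner x u (1, q) - cinner x w (1, q)\<bar> \<le> cdist x u w"
    using *[of u w] *[of w u] assms by (simp add: cdist_commute abs_le_iff)
  then have "r * \<bar>cinner x u (1, q) - cinner x w (1, q)\<bar> \<le> r * cdist x u w"
    using assms vq by (intro mult_left_mono) auto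
  moreover have "\<bar>cinner x u v - cinner x w v\<bar> = r * \<bar>cinner x u (1, q) - cinner x w (1, q)\<bar>"
    unfolding sc using assms vq by (simp add: right_diff_distrib[symmetric] abs_mult)
  moreover have "cnorm x v = r" using q by (simp add: cnorm_def vq)
  ultimately show ?thesis by simp
qed

lemma cinner_le:
  fixes x :: 'a
  assumes "fst u \<ge> 0" "fst w \<ge> 0"
  shows "cinner x u w \<le> cnorm x u * cnorm x w"
  using assms by (auto simp: cinner_def cnorm_def intro: mult_left_le)

lemma cdist_sq:
  fixes x :: 'a
  assumes "fst u \<ge> 0" "fst w \<ge> 0"
  shows "(cdist x u w)\<^sup>2 = (cnorm x u)\<^sup>2 + (cnorm x w)\<^sup>2 - 2 * cinner x u w"
proof -
  have "(cnorm x u - cnorm x w)\<^sup>2 \<ge> 0" by simp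
  then have "(cnorm x u)\<^sup>2 + (cnorm x w)\<^sup>2 - 2 * cinner x u w \<ge> 0"
    using cinner_le[OF assms, of x] by (simp add: power2_diff)
  then show ?thesis by (simp add: cdist_def)
qed

lemma cnorm_diff_le:
  fixes x :: 'a
  assumes "fst u \<ge> 0" "fst w \<ge> 0"
  shows "\<bar>cnorm x u - cnorm x w\<bar> \<le> cdist x u w"
proof (rule power2_le_imp_le)
  show "\<bar>cnorm x u - cnorm x w\<bar>\<^sup>2 \<le> (cdist x u w)\<^sup>2"
    using cinner_le[OF assms, of x] by (simp add: cdist_sq assms power2_diff)
qed (rule cdist_nonneg[OF assms])

text \<open>Aleksandrov angles are at most comparison angles, so the law of cosines survives as an
  inequality. Every later lower bound on the pairing of two logarithms, and with it the descent
  inequality, rests on this.\<close>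

lemma cinner_log_ge:
  fixes x a b :: 'a
  shows "(dist x a)\<^sup>2 + (dist x b)\<^sup>2 - (dist a b)\<^sup>2 \<le> 2 * cinner x (dist x a, a) (dist x b, b)"
proof (cases "a = x \<or> b = x")
  case True
  then show ?thesis by (auto simp: cinner_def dist_commute)
next
  case False
  then have "dist x a * dist x b * ccos x a b \<le> dist x a * dist x b * cos (aangle x a b)"
    by (intro mult_left_mono ccos_le_cos_aangle) auto
  then show ?thesis using False cos_law[of a x b] by (simp add: cinner_def)
qed

lemma cnorm_log: "cnorm x (dist x a, a) = dist x a"
  by (simp add: cnorm_def)

lemma cdist_log_le:
  fixes x a b :: 'a
  shows "cdist x (dist x a, a) (dist x b, b) \<le> dist a b"
proof (rule power2_le_imp_le)
  have "(cdist x (dist x a, a) (dist x b, b))\<^sup>2 =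
      (dist x a)\<^sup>2 + (dist x b)\<^sup>2 - 2 * cinner x (dist x a, a) (dist x b, b)"
    by (subst cdist_sq) (simp_all add: cnorm_log)
  then show "(cdist x (dist x a, a) (dist x b, b))\<^sup>2 \<le> (dist a b)\<^sup>2"
    using cinner_log_ge[of x a b] by linarith
qed simp

end

section \<open>Tangent vectors: norm, inner product and distance on the completion\<close>

context hadamard_space
begin

lemma tangent_nonneg: "v \<in> tangent x \<Longrightarrow> fst (v n) \<ge> 0"
  by (simp add: tangent_def)

text \<open>Norm and inner product of tangent vectors are bare \<open>lim\<close>s over
  representatives, so convergence must be secured each time; a Lipschitz bound along the Cauchy
  sequence does it.\<close>

lemma tangent_convergent:
  fixes f :: "nat \<Rightarrow> real" and x :: 'a
  assumes v: "v \<in> tangent x" and f: "\<And>m n. \<bar>f m - f n\<bar> \<le> K * cdist x (v m) (v n)"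
  shows "convergent f"
proof (rule Cauchy_convergent, rule metric_CauchyI)
  fix e :: real assume "e > 0"
  then have "e / (\<bar>K\<bar> + 1) > 0" by simp
  then obtain N where N: "\<And>m n. m \<ge> N \<Longrightarrow> n \<ge> N \<Longrightarrow> cdist x (v m) (v n) < e / (\<bar>K\<bar> + 1)"
    using v unfolding tangent_def by blast
  have "dist (f m) (f n) < e" if "m \<ge> N" "n \<ge> N" for m n
  proof -
    have "\<bar>f m - f n\<bar> \<le> K * cdist x (v m) (v n)" by (rule f)
    also have "\<dots> \<le> (\<bar>K\<bar> + 1) * cdist x (v m) (v n)"
      by (intro mult_right_mono cdist_nonneg tangent_nonneg[OF v]) auto
    also have "\<dots> < e"
      using N[OF that] by (simp add: pos_less_divide_eq mult.commute)
    finally show ?thesis by (simp add: dist_real_def)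
  qed
  then show "\<exists>N. \<forall>m\<ge>N. \<forall>n\<ge>N. dist (f m) (f n) < e" by blast
qed

lemma cdist_self: "fst v \<ge> 0 \<Longrightarrow> cdist x v v = 0"
  for x :: 'a
  using tendsto_cdist[of v v x] by (simp add: tendsto_const_iff)

lemma const_tangent: "r \<ge> 0 \<Longrightarrow> (\<lambda>_. (r, a)) \<in> tangent x"
  for x :: 'a
  by (auto simp: tangent_def cdist_self)

lemma tlog_tangent: "tlog x a \<in> tangent x"
  for x :: 'a
  unfolding tlog_def by (rule const_tangent) simp

lemma tzero_tangent: "tzero x \<in> tangent x"
  for x :: 'a
  unfolding tzero_def by (rule const_tangent) simp

lemma tscale_tlog_tangent: "k \<ge> 0 \<Longrightarrow> tscale k (tlog x a) \<in> tangent x"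
  for x :: 'a
  unfolding tlog_def tscale_def by (simp add: const_tangent)

lemma tnorm_tendsto:
  fixes x :: 'a
  assumes "v \<in> tangent x"
  shows "(\<lambda>n. cnorm x (v n)) \<longlonglongrightarrow> tnorm x v"
proof -
  have "convergent (\<lambda>n. cnorm x (v n))"
    by (rule tangent_convergent[OF assms, of _ 1]) (simp add: cnorm_diff_le tangent_nonneg[OF assms])
  then show ?thesis unfolding tnorm_def by (simp add: convergent_LIMSEQ_iff)
qed

lemma tnorm_nonneg: "v \<in> tangent x \<Longrightarrow> tnorm x v \<ge> 0"
  for x :: 'a
  using tnorm_tendsto[of v x] by (rule LIMSEQ_le_const) (auto intro: cnorm_nonneg tangent_nonneg)

lemma tinner_tendsto:
  fixes x :: 'a
  assumes "v \<in> tangent x"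
  shows "(\<lambda>n. cinner x (v n) (dist x a, a)) \<longlonglongrightarrow> tinner x v (tlog x a)"
proof -
  have "convergent (\<lambda>n. cinner x (v n) (dist x a, a))"
    by (rule tangent_convergent[OF assms, of _ "dist x a"])
      (rule order_trans[OF cinner_diff_le], simp_all add: cnorm_log tangent_nonneg[OF assms])
  then show ?thesis unfolding tinner_def tlog_def by (simp add: convergent_LIMSEQ_iff)
qed

lemma tdist_tendsto:
  fixes x :: 'a
  assumes v: "v \<in> tangent x" and w: "w \<in> tangent x"
  shows "(\<lambda>n. cdist x (v n) (w n)) \<longlonglongrightarrow> tdist x v w"
proof -
  have "Cauchy (\<lambda>n. cdist x (v n) (w n))"
  proof (rule metric_CauchyI)
    fix e :: real assume "e > 0"
    then have e: "e / 2 > 0" by simp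
    obtain N1 where N1: "\<And>m n. m \<ge> N1 \<Longrightarrow> n \<ge> N1 \<Longrightarrow> cdist x (v m) (v n) < e / 2"
      using v e unfolding tangent_def by blast
    obtain N2 where N2: "\<And>m n. m \<ge> N2 \<Longrightarrow> n \<ge> N2 \<Longrightarrow> cdist x (w m) (w n) < e / 2"
      using w e unfolding tangent_def by blast
    have *: "cdist x (v m) (w m) - cdist x (v n) (w n) < e" if "m \<ge> max N1 N2" "n \<ge> max N1 N2" for m n
    proof -
      have "cdist x (v m) (w m) \<le> cdist x (v m) (v n) + cdist x (v n) (w m)"
        by (intro cdist_triangle tangent_nonneg[OF v] tangent_nonneg[OF w])
      also have "cdist x (v n) (w m) \<le> cdist x (v n) (w n) + cdist x (w n) (w m)"
        by (intro cdist_triangle tangent_nonneg[OF v] tangent_nonneg[OF w])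
      finally show ?thesis using N1[of m n] N2[of n m] that by auto
    qed
    have "dist (cdist x (v m) (w m)) (cdist x (v n) (w n)) < e" if "m \<ge> max N1 N2" "n \<ge> max N1 N2" for m n
      using *[OF that] *[OF that(2,1)] by (simp add: dist_real_def abs_less_iff)
    then show "\<exists>N. \<forall>m\<ge>N. \<forall>n\<ge>N. dist (cdist x (v m) (w m)) (cdist x (v n) (w n)) < e" by blast
  qed
  then show ?thesis unfolding tdist_def using Cauchy_convergent convergent_LIMSEQ_iff by blast
qed

lemma tinner_tlog_self: "tinner x v (tlog x x) = 0"
  by (simp add: tinner_def tlog_def cinner_def)

text \<open>Here the logarithm moves instead of v: symmetry of \<open>cinner\<close> reduces to
  \<open>cinner_diff_le\<close>, and \<open>cdist_log_le\<close> returns from the cone to the space.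
  It serves both the descent step and continuity in the base point for measurability.\<close>

lemma tinner_lipschitz:
  fixes x :: 'a
  assumes v: "v \<in> tangent x"
  shows "\<bar>tinner x v (tlog x a) - tinner x v (tlog x b)\<bar> \<le> tnorm x v * dist a b"
proof (rule LIMSEQ_le)
  show "(\<lambda>n. \<bar>cinner x (v n) (dist x a, a) - cinner x (v n) (dist x b, b)\<bar>)
      \<longlonglongrightarrow> \<bar>tinner x v (tlog x a) - tinner x v (tlog x b)\<bar>"
    by (intro tendsto_intros tinner_tendsto v)
  show "(\<lambda>n. cnorm x (v n) * dist a b) \<longlonglongrightarrow> tnorm x v * dist a b"
    by (intro tendsto_intros tnorm_tendsto v)
  have "\<bar>cinner x (v n) (dist x a, a) - cinner x (v n) (dist x b, b)\<bar> \<le> cnorm x (v n) * dist a b" for n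
  proof -
    have "\<bar>cinner x (v n) (dist x a, a) - cinner x (v n) (dist x b, b)\<bar>
        = \<bar>cinner x (dist x a, a) (v n) - cinner x (dist x b, b) (v n)\<bar>"
      by (simp only: cinner_commute)
    also have "\<dots> \<le> cnorm x (v n) * cdist x (dist x a, a) (dist x b, b)"
      by (rule cinner_diff_le) (simp_all add: tangent_nonneg[OF v])
    also have "\<dots> \<le> cnorm x (v n) * dist a b"
      by (intro mult_left_mono cdist_log_le cnorm_nonneg tangent_nonneg[OF v])
    finally show ?thesis .
  qed
  then show "\<exists>N. \<forall>n\<ge>N. \<bar>cinner x (v n) (dist x a, a) - cinner x (v n) (dist x b, b)\<bar> \<le> cnorm x (v n) * dist a b"
    by blast
qed

lemma abs_tinner_tlog_le:
  fixes x :: 'a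
  assumes "v \<in> tangent x"
  shows "\<bar>tinner x v (tlog x a)\<bar> \<le> tnorm x v * dist x a"
  using tinner_lipschitz[OF assms, of a x] by (simp add: tinner_tlog_self dist_commute)

text \<open>\<open>tmem\<close> identifies representatives at \<open>tdist\<close> 0, so pairings
  must not distinguish them.\<close>

lemma tinner_tlog_cong:
  fixes x :: 'a
  assumes v: "v \<in> tangent x" and w: "w \<in> tangent x" and 0: "tdist x v w = 0"
  shows "tinner x v (tlog x a) = tinner x w (tlog x a)"
proof -
  have "(\<lambda>n. \<bar>cinner x (v n) (dist x a, a) - cinner x (w n) (dist x a, a)\<bar>)
      \<longlonglongrightarrow> \<bar>tinner x v (tlog x a) - tinner x w (tlog x a)\<bar>"
    by (intro tendsto_intros tinner_tendsto v w)
  moreover have "(\<lambda>n. dist x a * cdist x (v n) (w n)) \<longlonglongrightarrow> dist x a * 0"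
    using tdist_tendsto[OF v w] 0 by (intro tendsto_intros) simp
  moreover have "\<bar>cinner x (v n) (dist x a, a) - cinner x (w n) (dist x a, a)\<bar> \<le> dist x a * cdist x (v n) (w n)" for n
    using cinner_diff_le[of "v n" "w n" "(dist x a, a)" x] tangent_nonneg[OF v] tangent_nonneg[OF w]
    by (simp add: cnorm_log)
  ultimately have "\<bar>tinner x v (tlog x a) - tinner x w (tlog x a)\<bar> \<le> dist x a * 0"
    by (intro LIMSEQ_le) auto
  then show ?thesis by simp
qed

text \<open>Polarization: measurability of a selection is tested on \<open>tdist\<close> alone, and
  this recovers inner products from distances.\<close>

lemma tdist_tlog_sq:
  fixes x :: 'a
  assumes v: "v \<in> tangent x"
  shows "(tdist x v (tlog x a))\<^sup>2 = (tnorm x v)\<^sup>2 + (dist x a)\<^sup>2 - 2 * tinner x v (tlog x a)"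
proof (rule LIMSEQ_unique)
  show "(\<lambda>n. (cdist x (v n) (tlog x a n))\<^sup>2) \<longlonglongrightarrow> (tdist x v (tlog x a))\<^sup>2"
    by (intro tendsto_intros tdist_tendsto v tlog_tangent)
  have "(\<lambda>n. (cnorm x (v n))\<^sup>2 + (dist x a)\<^sup>2 - 2 * cinner x (v n) (dist x a, a))
      \<longlonglongrightarrow> (tnorm x v)\<^sup>2 + (dist x a)\<^sup>2 - 2 * tinner x v (tlog x a)"
    by (intro tendsto_intros tnorm_tendsto tinner_tendsto v)
  then show "(\<lambda>n. (cdist x (v n) (tlog x a n))\<^sup>2)
      \<longlonglongrightarrow> (tnorm x v)\<^sup>2 + (dist x a)\<^sup>2 - 2 * tinner x v (tlog x a)"
    by (simp add: cdist_sq tangent_nonneg[OF v] tlog_def cnorm_log)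
qed

lemma tdist_tzero:
  fixes x :: 'a
  assumes v: "v \<in> tangent x"
  shows "tdist x v (tzero x) = tnorm x v"
proof -
  have "tzero x = tlog x x" by (simp add: tzero_def tlog_def)
  then have "(tdist x v (tzero x))\<^sup>2 = (tnorm x v)\<^sup>2"
    using tdist_tlog_sq[OF v, of x] by (simp add: tinner_tlog_self)
  moreover have "tdist x v (tzero x) \<ge> 0"
    by (rule LIMSEQ_le_const[OF tdist_tendsto[OF v tzero_tangent]])
      (auto intro!: cdist_nonneg tangent_nonneg[OF v] tangent_nonneg[OF tzero_tangent])
  ultimately show ?thesis using tnorm_nonneg[OF v] by (simp add: power2_eq_iff_nonneg)
qed

lemma tinner_tscale_tlog_ge:
  fixes x :: 'a
  assumes "k \<ge> 0"
  shows "k * ((dist x a)\<^sup>2 + (dist x b)\<^sup>2 - (dist a b)\<^sup>2) \<le> 2 * tinner x (tscale k (tlog x a)) (tlog x b)"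
proof -
  have "tinner x (tscale k (tlog x a)) (tlog x b) = k * cinner x (dist x a, a) (dist x b, b)"
    by (simp add: tinner_def tscale_def tlog_def cinner_def)
  then show ?thesis using mult_left_mono[OF cinner_log_ge[of x a b] assms] by simp
qed

section \<open>Monotone fields and their resolvents\<close>

text \<open>A resolvent satisfies its inclusion only up to \<open>tdist\<close> 0, so monotonicity
  has to be transferred from representatives. The modulus is an arbitrary real, so that \<alpha> = 0
  covers plain monotonicity.\<close>

lemma monotone_tmem:
  fixes A :: "'a \<Rightarrow> 'a tvec set"
  assumes A: "vfield A"
    and mono: "\<And>x y u v. u \<in> A x \<Longrightarrow> v \<in> A y \<Longrightarrow>
      tinner x u (tlog x y) \<le> - tinner y v (tlog y x) - \<alpha> * (dist x y)\<^sup>2"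
    and x: "u \<in> tangent x" "tmem x u (A x)" and y: "v \<in> tangent y" "tmem y v (A y)"
  shows "tinner x u (tlog x y) \<le> - tinner y v (tlog y x) - \<alpha> * (dist x y)\<^sup>2"
proof -
  obtain u' where u': "u' \<in> A x" "tdist x u u' = 0" using x unfolding tmem_def by blast
  obtain v' where v': "v' \<in> A y" "tdist y v v' = 0" using y unfolding tmem_def by blast
  have "u' \<in> tangent x" "v' \<in> tangent y" using A u' v' unfolding vfield_def by blast+
  then show ?thesis
    using mono[OF u'(1) v'(1)] tinner_tlog_cong x y u' v' by metis
qed

text \<open>Monotonicity at two resolvent points, with both pairings bounded below by comparison;
  the common factor \<open>1 / lam\<close> drops out. Taking \<open>w1 = w2\<close> gives uniqueness
  of the resolvent, different points give its continuity.\<close>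

lemma resolvent_pair:
  fixes A :: "'a \<Rightarrow> 'a tvec set"
  assumes A: "vfield A" "monotone_vf A" and lam: "lam > 0"
    and 1: "tmem z1 (tscale (1 / lam) (tlog z1 w1)) (A z1)"
    and 2: "tmem z2 (tscale (1 / lam) (tlog z2 w2)) (A z2)"
  shows "2 * (dist z1 z2)\<^sup>2 \<le> (dist z2 w1)\<^sup>2 - (dist z1 w1)\<^sup>2 + (dist z1 w2)\<^sup>2 - (dist z2 w2)\<^sup>2"
proof -
  let ?a = "(dist z1 w1)\<^sup>2 + (dist z1 z2)\<^sup>2 - (dist w1 z2)\<^sup>2"
  let ?b = "(dist z2 w2)\<^sup>2 + (dist z2 z1)\<^sup>2 - (dist w2 z1)\<^sup>2"
  have "tinner z1 (tscale (1 / lam) (tlog z1 w1)) (tlog z1 z2) \<le>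
      - tinner z2 (tscale (1 / lam) (tlog z2 w2)) (tlog z2 z1) - 0 * (dist z1 z2)\<^sup>2"
    by (rule monotone_tmem[OF A(1) _ _ 1 _ 2])
      (use A(2) lam in \<open>auto simp: monotone_vf_def intro!: tscale_tlog_tangent\<close>)
  moreover have "(1 / lam) * ?a \<le> 2 * tinner z1 (tscale (1 / lam) (tlog z1 w1)) (tlog z1 z2)"
    by (rule tinner_tscale_tlog_ge) (use lam in simp)
  moreover have "(1 / lam) * ?b \<le> 2 * tinner z2 (tscale (1 / lam) (tlog z2 w2)) (tlog z2 z1)"
    by (rule tinner_tscale_tlog_ge) (use lam in simp)
  ultimately have "(1 / lam) * ?a + (1 / lam) * ?b \<le> 0" by linarith
  then have "(1 / lam) * (?a + ?b) \<le> 0" by (simp only: distrib_left)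
  then have "?a + ?b \<le> 0" using lam by (simp add: divide_le_0_iff)
  then show ?thesis by (simp add: dist_commute)
qed

lemma resolvent_tmem:
  fixes A :: "'a \<Rightarrow> 'a tvec set"
  assumes A: "vfield A" "monotone_vf A" "surjectivity_cond A" and lam: "lam > 0"
  shows "tmem (resolvent A lam w) (tscale (1 / lam) (tlog (resolvent A lam w) w)) (A (resolvent A lam w))"
  unfolding resolvent_def
proof (rule theI')
  show "\<exists>!z. tmem z (tscale (1 / lam) (tlog z w)) (A z)"
  proof (rule ex_ex1I)
    show "\<exists>z. tmem z (tscale (1 / lam) (tlog z w)) (A z)"
      using A(3) lam unfolding surjectivity_cond_def by blast
    fix z1 z2 assume "tmem z1 (tscale (1 / lam) (tlog z1 w)) (A z1)" "tmem z2 (tscale (1 / lam) (tlog z2 w)) (A z2)"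
    from resolvent_pair[OF A(1,2) lam this] show "z1 = z2" by simp
  qed
qed

text \<open>The four squared distances in \<open>resolvent_pair\<close> form two differences with a
  common vertex, each at most \<open>dist w1 w2\<close> times a sum of distances. The result is a
  local Hoelder bound of exponent 1/2. Continuity in the point is one half of the Caratheodory
  condition that makes the iterates measurable.\<close>

lemma continuous_resolvent:
  fixes A :: "'a \<Rightarrow> 'a tvec set"
  assumes A: "vfield A" "monotone_vf A" "surjectivity_cond A" and lam: "lam > 0"
  shows "continuous_on UNIV (resolvent A lam)"
  unfolding continuous_on_def
proof
  fix w1 :: 'a
  define z1 where "z1 = resolvent A lam w1"
  define r where "r = dist z1 w1"
  have key: "(dist (resolvent A lam w2) z1)\<^sup>2 \<le> dist w1 w2 * (4 * r + 3 * dist w1 w2)" for w2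
  proof -
    define z2 where "z2 = resolvent A lam w2"
    define h where "h = dist w1 w2"
    define d where "d = dist z1 z2"
    have h: "h \<ge> 0" unfolding h_def by simp
    have tri: "\<bar>a\<^sup>2 - b\<^sup>2\<bar> \<le> h * (a + b)" if "\<bar>a - b\<bar> \<le> h" "a \<ge> 0" "b \<ge> 0" for a b :: real
    proof -
      have "\<bar>a\<^sup>2 - b\<^sup>2\<bar> = \<bar>a - b\<bar> * (a + b)"
        using that by (simp add: power2_eq_square square_diff_square_factored abs_mult mult.commute)
      also have "\<dots> \<le> h * (a + b)" using that by (intro mult_right_mono) auto
      finally show ?thesis .
    qed
    have "2 * d\<^sup>2 \<le> ((dist z2 w1)\<^sup>2 - (dist z2 w2)\<^sup>2) + ((dist z1 w2)\<^sup>2 - (dist z1 w1)\<^sup>2)"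
      using resolvent_pair[OF A(1,2) lam resolvent_tmem[OF A lam, of w1] resolvent_tmem[OF A lam, of w2]]
      by (simp add: z1_def z2_def d_def)
    also have "\<dots> \<le> h * (dist z2 w1 + dist z2 w2) + h * (dist z1 w2 + dist z1 w1)"
      by (intro add_mono order_trans[OF abs_ge_self tri])
        (auto simp: h_def abs_le_iff, (metis dist_commute dist_triangle add.commute diff_le_eq)+)
    also have "\<dots> = h * (dist z2 w1 + dist z2 w2 + dist z1 w2 + dist z1 w1)"
      by (simp add: algebra_simps)
    also have "\<dots> \<le> h * ((d + r) + (d + r + h) + (r + h) + r)"
    proof (intro mult_left_mono add_mono)
      show "dist z2 w1 \<le> d + r" unfolding d_def r_def by (metis dist_commute dist_triangle)
      show "dist z1 w2 \<le> r + h" unfolding h_def r_def by (rule dist_triangle)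
      then show "dist z2 w2 \<le> d + r + h" unfolding d_def
        using dist_triangle[of z2 w2 z1] by (simp add: dist_commute)
    qed (use h in \<open>auto simp: r_def\<close>)
    also have "\<dots> = 2 * (h * d) + h * (4 * r + 2 * h)" by (simp add: algebra_simps)
    \<comment> \<open>Young's inequality uses up one of the two copies of d^2 on the left.\<close>
    also have "2 * (h * d) \<le> h\<^sup>2 + d\<^sup>2" using sum_squares_bound[of h d] by simp
    finally have "d\<^sup>2 \<le> h * (4 * r + 3 * h)" by (simp add: algebra_simps power2_eq_square)
    then show ?thesis by (simp add: d_def h_def z2_def dist_commute)
  qed
  have "((\<lambda>w. dist (resolvent A lam w) z1) \<longlongrightarrow> 0) (at w1)"
  proof (rule tendsto_sandwich[OF _ _ tendsto_const])
    show "((\<lambda>w. sqrt (dist w1 w * (4 * r + 3 * dist w1 w))) \<longlongrightarrow> 0) (at w1)"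
      by (auto intro!: tendsto_eq_intros)
    show "eventually (\<lambda>w. dist (resolvent A lam w) z1 \<le> sqrt (dist w1 w * (4 * r + 3 * dist w1 w))) (at w1)"
      using key by (intro always_eventually allI real_le_rsqrt)
  qed auto
  then show "(resolvent A lam \<longlongrightarrow> resolvent A lam w1) (at w1 within UNIV)"
    by (subst tendsto_dist_iff) (simp add: z1_def)
qed

text \<open>Monotonicity produces the pairing of \<phi> with the logarithm of the new point z, but
  the condition on conditional means speaks of the old point w. Lipschitz continuity exchanges z for
  w at the price \<open>tnorm y \<phi> * dist z w\<close>, and comparison at z supplies
  \<open>- (dist z w)^2\<close>, which can later absorb it.\<close>

lemma resolvent_step:
  fixes w :: 'a
  assumes A: "vfield A" "monotone_vf A" "surjectivity_cond A" and lam: "lam > 0"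
    and strong: "strongly_monotone_vf A \<alpha>"
    and \<phi>: "\<phi> \<in> tangent y" "tmem y \<phi> (A y)"
  defines "z \<equiv> resolvent A lam w"
  shows "(1 + 2 * lam * \<alpha>) * (dist z y)\<^sup>2 \<le> (dist w y)\<^sup>2 - 2 * lam * tinner y \<phi> (tlog y w)
    - (dist z w)\<^sup>2 + 2 * lam * tnorm y \<phi> * dist z w"
proof -
  let ?v = "tscale (1 / lam) (tlog z w)"
  have "tinner y \<phi> (tlog y z) \<le> - tinner z ?v (tlog z y) - \<alpha> * (dist y z)\<^sup>2"
    by (rule monotone_tmem[OF A(1) _ \<phi>])
      (use strong lam resolvent_tmem[OF A lam, of w] in
        \<open>auto simp: strongly_monotone_vf_def z_def intro!: tscale_tlog_tangent\<close>)
  moreover have "\<bar>tinner y \<phi> (tlog y w) - tinner y \<phi> (tlog y z)\<bar> \<le> tnorm y \<phi> * dist w z"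
    by (rule tinner_lipschitz[OF \<phi>(1)])
  moreover have "(1 / lam) * ((dist z w)\<^sup>2 + (dist z y)\<^sup>2 - (dist w y)\<^sup>2) \<le> 2 * tinner z ?v (tlog z y)"
    by (rule tinner_tscale_tlog_ge) (use lam in simp)
  ultimately have "(1 / lam) * ((dist z w)\<^sup>2 + (dist z y)\<^sup>2 - (dist w y)\<^sup>2) \<le>
      2 * (tnorm y \<phi> * dist z w - tinner y \<phi> (tlog y w) - \<alpha> * (dist z y)\<^sup>2)"
    by (simp add: dist_commute)
  then have "lam * ((1 / lam) * ((dist z w)\<^sup>2 + (dist z y)\<^sup>2 - (dist w y)\<^sup>2)) \<le>
      lam * (2 * (tnorm y \<phi> * dist z w - tinner y \<phi> (tlog y w) - \<alpha> * (dist z y)\<^sup>2))"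
    using lam by (intro mult_left_mono) auto
  then show ?thesis using lam by (simp add: algebra_simps)
qed

lemma tnorm_yosida:
  assumes "lam > 0"
  shows "tnorm (resolvent A lam w) (yosida A lam w) = dist (resolvent A lam w) w / lam"
  by (simp add: tnorm_def yosida_def tscale_def tlog_def cnorm_def)

end

section \<open>Joint measurability and the natural filtration\<close>

text \<open>Replace \<open>g w\<close> by the first member of a dense sequence within
  \<open>1 / (n + 1)\<close>. With countably many values only the sections of f matter, and
  continuity in the second argument passes to the limit.\<close>

lemma borel_measurable_caratheodory:
  fixes f :: "'s \<Rightarrow> 'x::{metric_space,second_countable_topology} \<Rightarrow> 'y::metric_space"
  assumes f: "\<And>y. (\<lambda>s. f s y) \<in> borel_measurable M"
    and cont: "\<And>s. s \<in> space M \<Longrightarrow> continuous_on UNIV (f s)"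
    and h[measurable]: "h \<in> measurable N M" and g[measurable]: "g \<in> borel_measurable N"
  shows "(\<lambda>w. f (h w) (g w)) \<in> borel_measurable N"
proof -
  obtain D :: "'x set" where D: "countable D" "\<And>X. open X \<Longrightarrow> X \<noteq> {} \<Longrightarrow> \<exists>d\<in>D. d \<in> X"
    using countable_dense_setE by metis
  have D0: "D \<noteq> {}" using D(2)[of UNIV] by auto
  define e where "e = from_nat_into D"
  define k where "k n w = (LEAST i. dist (g w) (e i) < inverse (real (Suc n)))" for n w
  have k: "dist (g w) (e (k n w)) < inverse (real (Suc n))" for n w
  proof -
    obtain d where "d \<in> D" "d \<in> ball (g w) (inverse (real (Suc n)))"
      using D(2)[of "ball (g w) (inverse (real (Suc n)))"] by fastforce
    then have "\<exists>i. dist (g w) (e i) < inverse (real (Suc n))"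
      using from_nat_into_surj[OF D(1)] unfolding e_def by (metis mem_ball)
    then show ?thesis unfolding k_def by (rule LeastI_ex)
  qed
  have [measurable]: "k n \<in> measurable N (count_space UNIV)" for n
    unfolding k_def by measurable
  show ?thesis
  proof (rule borel_measurable_LIMSEQ_metric)
    show "(\<lambda>w. f (h w) (e (k n w))) \<in> borel_measurable N" for n
    proof (rule measurable_compose_countable[where f="\<lambda>i w. f (h w) (e i)"])
      show "(\<lambda>w. f (h w) (e i)) \<in> borel_measurable N" for i
        using measurable_compose[OF h f] .
    qed measurable
    fix w assume "w \<in> space N"
    then have "h w \<in> space M" using h by (rule measurable_space[rotated])
    moreover have "(\<lambda>n. e (k n w)) \<longlonglongrightarrow> g w"
    proof (rule tendstoI)
      fix r :: real assume "r > 0"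
      then have "eventually (\<lambda>n. inverse (real (Suc n)) < r) sequentially"
        using LIMSEQ_inverse_real_of_nat order_tendstoD(2) by blast
      then show "eventually (\<lambda>n. dist (e (k n w)) (g w) < r) sequentially"
        by (rule eventually_mono) (metis k dist_commute order_less_trans)
    qed
    ultimately show "(\<lambda>n. f (h w) (e (k n w))) \<longlonglongrightarrow> f (h w) (g w)"
      by (rule continuous_on_tendsto_compose[OF cont]) auto
  qed
qed

lemma space_nat_filtration [simp]: "space (nat_filtration P M \<xi> n) = space P"
  unfolding nat_filtration_def by (rule space_measure_of) auto

text \<open>Generators grouped by index, the shape in which independence of blocks of variables is
  available.\<close>

lemma sets_nat_filtration:
  "sets (nat_filtration P M \<xi> n) =
    sigma_sets (space P) (\<Union>i\<in>{1..n}. {\<xi> i -` B \<inter> space P | B. B \<in> sets M})"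
proof -
  have "{\<xi> i -` B \<inter> space P | i B. i \<in> {1..n} \<and> B \<in> sets M} =
    (\<Union>i\<in>{1..n}. {\<xi> i -` B \<inter> space P | B. B \<in> sets M})" by blast
  then show ?thesis
    unfolding nat_filtration_def by (subst sets_measure_of) auto
qed

lemma subalgebra_nat_filtration:
  assumes "\<And>i. 1 \<le> i \<Longrightarrow> i \<le> n \<Longrightarrow> \<xi> i \<in> measurable P M"
  shows "subalgebra P (nat_filtration P M \<xi> n)"
  unfolding subalgebra_def sets_nat_filtration
  by (auto intro!: sets.sigma_sets_subset measurable_sets[OF assms])

lemma measurable_nat_filtration:
  assumes "1 \<le> i" "i \<le> n" "\<xi> i \<in> measurable P M"
  shows "\<xi> i \<in> measurable (nat_filtration P M \<xi> n) M"
proof (rule measurableI)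
  fix B assume "B \<in> sets M"
  then show "\<xi> i -` B \<inter> space (nat_filtration P M \<xi> n) \<in> sets (nat_filtration P M \<xi> n)"
    unfolding sets_nat_filtration using assms by (intro sigma_sets.Basic UN_I[of i]) auto
qed (use assms in \<open>auto dest: measurable_space\<close>)

lemma measurable_nat_filtration_mono:
  assumes "f \<in> measurable (nat_filtration P M \<xi> n) N" "n \<le> k"
  shows "f \<in> measurable (nat_filtration P M \<xi> k) N"
proof -
  have "sets (nat_filtration P M \<xi> n) \<subseteq> sets (nat_filtration P M \<xi> k)"
    unfolding sets_nat_filtration using assms(2) by (intro sigma_sets_mono' UN_mono) auto
  then show ?thesis using assms(1) unfolding measurable_def by auto
qed

text \<open>Past and next sample are generated by the disjoint index blocks \<open>{1..n}\<close>
  and \<open>{Suc n}\<close> of an independent family of intersection-stable systems; f and h only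
  have to be measurable for the generated sigma-algebras.\<close>

lemma (in prob_space) indep_nat_filtration:
  fixes f h :: "_ \<Rightarrow> real"
  assumes ind: "indep_vars (\<lambda>_. N) \<xi> {1..}"
    and f: "f \<in> borel_measurable (nat_filtration M N \<xi> n)" and h: "h \<in> borel_measurable N"
  shows "indep_var borel f borel (\<lambda>w. h (\<xi> (Suc n) w))"
  unfolding indep_var_eq
proof (intro conjI)
  have \<xi>: "\<xi> i \<in> measurable M N" if "i \<ge> 1" for i
    using ind that unfolding indep_vars_def2 by auto
  show "f \<in> borel_measurable M"
    by (rule measurable_from_subalg[OF subalgebra_nat_filtration f]) (use \<xi> in auto)
  show "(\<lambda>w. h (\<xi> (Suc n) w)) \<in> borel_measurable M"
    using \<xi>[of "Suc n"] h by (auto intro: measurable_compose)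
  define E where "E i = {\<xi> i -` A \<inter> space M | A. A \<in> sets N}" for i
  define I where "I b = (if b then {1..n} else {Suc n})" for b
  have "indep_sets E {1..}"
    using ind unfolding indep_vars_def2 E_def by auto
  then have "indep_sets E (\<Union>b\<in>UNIV. I b)"
    by (rule indep_sets_mono_index[rotated]) (auto simp: I_def split: if_splits)
  moreover have "Int_stable (E i)" for i
    unfolding E_def Int_stable_def
  proof safe
    fix A B assume "A \<in> sets N" "B \<in> sets N"
    then show "\<exists>C. \<xi> i -` A \<inter> space M \<inter> (\<xi> i -` B \<inter> space M) = \<xi> i -` C \<inter> space M \<and> C \<in> sets N"
      by (intro exI[of _ "A \<inter> B"]) auto
  qed
  moreover have "disjoint_family_on I UNIV" by (auto simp: disjoint_family_on_def I_def)
  ultimately have "indep_sets (\<lambda>b. sigma_sets (space M) (\<Union>i\<in>I b. E i)) UNIV"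
    by (intro indep_sets_collect_sigma)
  then show "indep_set (sigma_sets (space M) {f -` A \<inter> space M |A. A \<in> sets borel})
     (sigma_sets (space M) {(\<lambda>w. h (\<xi> (Suc n) w)) -` A \<inter> space M |A. A \<in> sets borel})"
    unfolding indep_set_def
  proof (rule indep_sets_mono_sets)
    have *: "\<xi> (Suc n) -` (h -` A \<inter> space N) \<inter> space M = (\<lambda>w. h (\<xi> (Suc n) w)) -` A \<inter> space M" for A
      using measurable_space[OF \<xi>[of "Suc n"]] by auto
    have "sigma_sets (space M) {f -` A \<inter> space M |A. A \<in> sets borel}
        \<subseteq> sigma_sets (space M) (\<Union>i\<in>I True. E i)"
    proof (rule sigma_sets_mono, safe)
      fix A :: "real set" assume "A \<in> sets borel"
      then show "f -` A \<inter> space M \<in> sigma_sets (space M) (\<Union>i\<in>I True. E i)"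
        using measurable_sets[OF f, of A] by (simp add: sets_nat_filtration E_def I_def)
    qed
    moreover have "sigma_sets (space M) {(\<lambda>w. h (\<xi> (Suc n) w)) -` A \<inter> space M |A. A \<in> sets borel}
        \<subseteq> sigma_sets (space M) (\<Union>i\<in>I False. E i)"
    proof (rule sigma_sets_mono', safe)
      fix A :: "real set" assume "A \<in> sets borel"
      then have "h -` A \<inter> space N \<in> sets N" using h by (rule measurable_sets[rotated])
      then show "(\<lambda>w. h (\<xi> (Suc n) w)) -` A \<inter> space M \<in> (\<Union>i\<in>I False. E i)"
        unfolding I_def E_def by (auto simp: *[symmetric] simp del: vimage_Int)
    qed
    ultimately show "(case b of True \<Rightarrow> sigma_sets (space M) {f -` A \<inter> space M |A. A \<in> sets borel}
        | False \<Rightarrow> sigma_sets (space M) {(\<lambda>w. h (\<xi> (Suc n) w)) -` A \<inter> space M |A. A \<in> sets borel})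
        \<subseteq> sigma_sets (space M) (\<Union>i\<in>I b. E i)" for b
      by (cases b) auto
  qed
qed

section \<open>Numerical core of the recursion\<close>

text \<open>What \<open>step_constant_bound\<close> requires per unit of u when k = 1 and \<sigma>,
  c, h take their largest values. The difference of the sides is a^2 times the bracket displayed in
  the proof, whose first product is nonnegative exactly because \<open>a <= 1 / 2\<close>.\<close>

lemma poly_bound_small:
  fixes a :: real
  assumes "0 < a" "a \<le> 1 / 2"
  shows "(a\<^sup>2 / 2) * (1 - 4 / 5 * a^4) / 4 + 4 / 5 * a^4 + 2 * (a - a\<^sup>2) * a\<^sup>2 \<le> a\<^sup>2 * (1 - a\<^sup>2 / 4)"
proof -
  have "0 \<le> (1/2 - a) * (61/40 - 19/20 * a)"
    by (rule mult_nonneg_nonneg) (use assms in auto)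
  then have "0 \<le> a\<^sup>2 * ((1/2 - a) * (61/40 - 19/20 * a) + 9/80 + a^4 / 10)"
    by (intro mult_nonneg_nonneg[OF zero_le_power2] add_nonneg_nonneg) auto
  also have "\<dots> = a\<^sup>2 * (1 - a\<^sup>2 / 4) - ((a\<^sup>2 / 2) * (1 - 4 / 5 * a^4) / 4 + 4 / 5 * a^4 + 2 * (a - a\<^sup>2) * a\<^sup>2)"
    by (simp add: field_simps power2_eq_square power4_eq_xxxx)
  finally show ?thesis by simp
qed

text \<open>With a = (1 + s) / 2 the difference of the two sides has nonnegative coefficients in the
  Bernstein basis of degree 7 on [0, 1].\<close>

lemma poly_bound_large:
  fixes a :: real
  assumes "1 / 2 \<le> a" "a \<le> 1"
  shows "(2 * a - 1 + a\<^sup>2 / 2) * (1 - 4 / 5 * a^4) / 4 + 2 / 5 * a^3 + (1 - a) * a\<^sup>2 \<le> a\<^sup>2 * (1 - a\<^sup>2 / 4)"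
proof -
  define s where "s = 2 * a - 1"
  define r where "r = 1 - s"
  have s: "0 \<le> s" "0 \<le> r" using assms by (auto simp: s_def r_def)
  have a: "a = (1 + s) / 2" by (simp add: s_def)
  have "0 \<le> 19/640 * r^7 + 51/640 * (s * r^6) + 9/320 * (s^2 * r^5) + 33/320 * (s^3 * r^4)
    + 119/160 * (s^4 * r^3) + 43/32 * (s^5 * r^2) + s^6 * r + 11/40 * s^7"
    using s by (intro add_nonneg_nonneg mult_nonneg_nonneg zero_le_power) auto
  also have "\<dots> = a\<^sup>2 * (1 - a\<^sup>2 / 4) -
      ((2 * a - 1 + a\<^sup>2 / 2) * (1 - 4 / 5 * a^4) / 4 + 2 / 5 * a^3 + (1 - a) * a\<^sup>2)"
    unfolding r_def a by (simp add: field_simps eval_nat_numeral)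
  finally show ?thesis by simp
qed

text \<open>Every parameter is moved to its worst value: h to \<open>a^2 / 4\<close>, \<sigma> to
  \<open>(u - 2 * c) / 4\<close>, then c to \<open>2 / 5 * a^4 * u\<close>, and
  \<open>1 / (1 + h)\<close> is bounded below by \<open>1 - a^2 / 4\<close>. A polynomial inequality
  in a remains. The choice k = 1 throughout would not do: at a = 1 it would demand 33/40 <= 3/4. The
  maximum with 1 keeps the coefficient of \<sigma> nonnegative.\<close>

lemma step_constant_bound:
  fixes a h C c u \<sigma> :: real
  defines "k \<equiv> max 1 (2 * a)"
  assumes a: "0 < a" "a \<le> 1" and h: "0 \<le> h" "h \<le> a\<^sup>2 / 4"
    and c: "C \<le> c" "0 \<le> c" "c \<le> 2 / 5 * a^4 * u" and \<sigma>: "0 \<le> \<sigma>" "4 * \<sigma> + 2 * c \<le> u"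
  shows "(k - 1 + 2 * h) * \<sigma> + (2 * C + 8 * (a - a\<^sup>2) * (u * h)) / k \<le> a\<^sup>2 * u / (1 + h)"
proof -
  define t where "t = a\<^sup>2 / 4"
  have k: "k \<ge> 1" by (simp add: k_def)
  have u: "u \<ge> 0" using c \<sigma> by linarith
  have t: "h \<le> t" "0 \<le> t" "t \<le> 1 / 4" using h a power_le_one[of a 2] by (auto simp: t_def)
  have aa: "a - a\<^sup>2 \<ge> 0" using a by (simp add: power2_eq_square mult_left_le)
  have "(k - 1 + 2 * h) * \<sigma> + (2 * C + 8 * (a - a\<^sup>2) * (u * h)) / k
      \<le> (k - 1 + 2 * t) * ((u - 2 * c) / 4) + (2 * c + 8 * (a - a\<^sup>2) * (u * t)) / k"
    using k u t aa c \<sigma> h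
    by (intro add_mono mult_mono divide_right_mono mult_left_mono) auto
  also have "\<dots> = u * ((k - 1 + 2 * t) / 4 + 8 * (a - a\<^sup>2) * t / k) + c * (2 / k - (k - 1 + 2 * t) / 2)"
    using k by (simp add: field_simps)
  also have "\<dots> \<le> u * ((k - 1 + 2 * t) / 4 + 8 * (a - a\<^sup>2) * t / k) +
      (2 / 5 * a^4 * u) * (2 / k - (k - 1 + 2 * t) / 2)"
  proof -
    \<comment> \<open>Inserting the largest \<sigma> brought in a negative multiple of c. Its total
      coefficient is still nonnegative because k <= 2, so the largest c is the worst one.\<close>
    have "k \<le> 2" using a by (simp add: k_def)
    then have "2 / k \<ge> 1" "(k - 1 + 2 * t) / 2 \<le> 1" using t k by (auto simp: le_divide_eq)
    then have "2 / k - (k - 1 + 2 * t) / 2 \<ge> 0" by linarith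
    then show ?thesis using c by (intro add_left_mono mult_right_mono)
  qed
  also have "\<dots> = u * ((k - 1 + 2 * t) / 4 + 8 * (a - a\<^sup>2) * t / k +
      2 / 5 * a^4 * (2 / k - (k - 1 + 2 * t) / 2))"
    by (simp add: algebra_simps)
  also have "\<dots> \<le> u * (a\<^sup>2 * (1 - t))"
  proof (intro mult_left_mono u)
    show "(k - 1 + 2 * t) / 4 + 8 * (a - a\<^sup>2) * t / k + 2 / 5 * a^4 * (2 / k - (k - 1 + 2 * t) / 2)
      \<le> a\<^sup>2 * (1 - t)"
    proof (cases "a \<le> 1 / 2")
      case True
      then have k1: "k = 1" by (simp add: k_def)
      show ?thesis
        using poly_bound_small[OF a(1) True] unfolding k1 t_def by (simp add: field_simps eval_nat_numeral)
    next
      case False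
      then have k2: "k = 2 * a" by (simp add: k_def)
      have "(k - 1 + 2 * t) / 4 + 8 * (a - a\<^sup>2) * t / k + 2 / 5 * a^4 * (2 / k - (k - 1 + 2 * t) / 2) =
        (2 * a - 1 + a\<^sup>2 / 2) * (1 - 4 / 5 * a^4) / 4 + 2 / 5 * a^3 + (1 - a) * a\<^sup>2"
        using a(1) unfolding k2 t_def by (simp add: field_simps eval_nat_numeral)
      then show ?thesis
        using poly_bound_large[of a] False a by (simp add: t_def)
    qed
  qed
  also have "\<dots> \<le> a\<^sup>2 * u / (1 + h)"
  proof -
    have "(1 - t) * (1 + h) \<le> (1 - t) * (1 + t)" using t by (intro mult_left_mono) auto
    also have "\<dots> \<le> 1" using t by (simp add: algebra_simps)
    finally have "a\<^sup>2 * u * ((1 - t) * (1 + h)) \<le> a\<^sup>2 * u * 1" using u by (intro mult_left_mono) auto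
    then show ?thesis using h by (simp add: le_divide_eq mult_ac)
  qed
  finally show ?thesis .
qed

text \<open>Here e and e' stand for consecutive second moments and \<open>rec\<close> for the
  integrated descent step. The threshold on m is the condition \<open>h <= a^2 / 4\<close> of
  \<open>step_constant_bound\<close>.\<close>

lemma recursion_bound:
  fixes a m C c u \<sigma> e e' :: real
  defines "k \<equiv> max 1 (2 * a)"
  assumes a: "0 < a" "a \<le> 1" and m: "4 / a\<^sup>2 \<le> m"
    and c: "C \<le> c" "0 \<le> c" "c \<le> 2 / 5 * a^4 * u" and \<sigma>: "0 \<le> \<sigma>" "4 * \<sigma> + 2 * c \<le> u"
    and e: "e \<le> u / m"
    and rec: "(1 + 2 / m) * e' \<le> e + (1 / (a * m))\<^sup>2 * ((k - 1 + 2 / m) * \<sigma> + (2 * C + 8 * (a - a\<^sup>2) * e) / k)"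
  shows "e' \<le> u / (m + 1)"
proof -
  have k: "k \<ge> 1" by (simp add: k_def)
  have "4 / a\<^sup>2 > 0" using a by simp
  then have m0: "m > 0" using m by linarith
  define h where "h = 1 / m"
  have h: "h > 0" "h \<le> a\<^sup>2 / 4"
    using m0 m a by (auto simp: h_def field_simps)
  have aa: "a - a\<^sup>2 \<ge> 0" using a by (simp add: power2_eq_square mult_left_le)
  have "(1 + 2 * h) * e' \<le> e + (h\<^sup>2 / a\<^sup>2) * ((k - 1 + 2 * h) * \<sigma> + (2 * C + 8 * (a - a\<^sup>2) * e) / k)"
    using rec by (simp add: h_def power_divide power_mult_distrib divide_simps mult_ac)
  also have "\<dots> \<le> u * h + (h\<^sup>2 / a\<^sup>2) * ((k - 1 + 2 * h) * \<sigma> + (2 * C + 8 * (a - a\<^sup>2) * (u * h)) / k)"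
    using e aa k m0 by (intro add_mono mult_left_mono divide_right_mono) (auto simp: h_def)
  also have "\<dots> \<le> u * h + (h\<^sup>2 / a\<^sup>2) * (a\<^sup>2 * u / (1 + h))"
    unfolding k_def using step_constant_bound[OF a _ h(2) c \<sigma>] h
    by (intro add_left_mono mult_left_mono) auto
  also have "\<dots> = (1 + 2 * h) * (u * h / (1 + h))"
    using h a by (simp add: field_simps power2_eq_square)
  finally have "e' \<le> u * h / (1 + h)"
    by (rule mult_left_le_imp_le) (use h in simp)
  also have "\<dots> = u / (m + 1)" using m0 by (simp add: h_def field_simps)
  finally show ?thesis .
qed

text \<open>p is the sampled modulus and a its mean. Adding \<open>2 * L * (a - p) * y^2\<close> to
  \<open>step\<close> installs the mean on the left; exchanging y^2 for x^2 then leaves a product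
  that will have mean zero. The part of the exchange error linear in d joins
  \<open>2 * L * f * d\<close> before a single Young inequality with weight k treats both.\<close>

lemma strong_step_pointwise:
  fixes L p a k x y d f g :: real
  assumes step: "(1 + 2 * L * p) * y\<^sup>2 \<le> x\<^sup>2 - 2 * L * g - d\<^sup>2 + 2 * L * f * d"
    and diff: "\<bar>y - x\<bar> \<le> d" and nonneg: "0 \<le> x" "0 \<le> y" "0 \<le> p" "0 \<le> a" "0 \<le> L" and k: "1 \<le> k"
  shows "(1 + 2 * L * a) * y\<^sup>2 \<le> x\<^sup>2 - 2 * L * g + 2 * L * (x\<^sup>2 * (a - p)) +
    (k - 1 + 2 * L * a) * d\<^sup>2 + L\<^sup>2 * (2 * f\<^sup>2 + 8 * (x\<^sup>2 * (p - a)\<^sup>2)) / k"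
proof -
  have d: "d \<ge> 0" using diff by linarith
  define r where "r = \<bar>p - a\<bar>"
  have r: "r \<ge> 0" by (simp add: r_def)
  \<comment> \<open>The sign of a - p decides which one-sided estimate is used. For p > a the bound
    \<open>x^2 - y^2 <= 2 * x * d\<close> has no quadratic term, so d^2 is charged only when p <= a,
    with factor at most a.\<close>
  have "(a - p) * (y\<^sup>2 - x\<^sup>2) \<le> 2 * r * x * d + a * d\<^sup>2"
  proof (cases "p \<le> a")
    case True
    have "y\<^sup>2 \<le> (x + d)\<^sup>2" using diff nonneg by (intro power_mono) auto
    then have "(a - p) * (y\<^sup>2 - x\<^sup>2) \<le> (a - p) * (2 * x * d + d\<^sup>2)"
      using True by (intro mult_left_mono) (auto simp: power2_sum)
    also have "\<dots> = 2 * r * x * d + (a - p) * d\<^sup>2" using True by (simp add: r_def algebra_simps)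
    also have "\<dots> \<le> 2 * r * x * d + a * d\<^sup>2" using nonneg by (intro add_left_mono mult_right_mono) auto
    finally show ?thesis .
  next
    case False
    have "x\<^sup>2 - y\<^sup>2 \<le> 2 * x * d"
    proof (cases "y \<le> x")
      case True
      have "x\<^sup>2 - y\<^sup>2 = (x - y) * (x + y)" by (simp add: power2_eq_square algebra_simps)
      also have "\<dots> \<le> d * (2 * x)" using True nonneg diff by (intro mult_mono) auto
      finally show ?thesis by (simp add: mult_ac)
    next
      case False
      then have "x\<^sup>2 \<le> y\<^sup>2" using nonneg by (intro power_mono) auto
      moreover have "0 \<le> 2 * x * d" using nonneg d by simp
      ultimately show ?thesis by linarith
    qed
    then have "(p - a) * (x\<^sup>2 - y\<^sup>2) \<le> (p - a) * (2 * x * d)" using False by (intro mult_left_mono) auto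
    moreover have "(a - p) * (y\<^sup>2 - x\<^sup>2) = (p - a) * (x\<^sup>2 - y\<^sup>2)" by (simp add: algebra_simps)
    moreover have "(p - a) * (2 * x * d) = 2 * r * x * d" using False by (simp add: r_def)
    moreover have "a * d\<^sup>2 \<ge> 0" using nonneg by simp
    ultimately show ?thesis by linarith
  qed
  then have "2 * L * ((a - p) * (y\<^sup>2 - x\<^sup>2)) \<le> 2 * L * (2 * r * x * d + a * d\<^sup>2)"
    using nonneg by (intro mult_left_mono) auto
  then have 1: "2 * L * (a - p) * y\<^sup>2 \<le> 2 * L * (x\<^sup>2 * (a - p)) + 4 * L * r * x * d + 2 * L * a * d\<^sup>2"
    by (simp add: algebra_simps)
  have 2: "2 * L * f * d + 4 * L * r * x * d \<le> k * d\<^sup>2 + L\<^sup>2 * (2 * f\<^sup>2 + 8 * (x\<^sup>2 * (p - a)\<^sup>2)) / k"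
  proof -
    define b where "b = L * (f + 2 * r * x)"
    have "0 \<le> (k * d - b)\<^sup>2 / k" using k by simp
    also have "\<dots> = k * d\<^sup>2 - 2 * b * d + b\<^sup>2 / k" using k by (simp add: field_simps power2_eq_square)
    finally have "2 * b * d \<le> k * d\<^sup>2 + b\<^sup>2 / k" by simp
    also have "b\<^sup>2 / k \<le> L\<^sup>2 * (2 * f\<^sup>2 + 8 * (x\<^sup>2 * (p - a)\<^sup>2)) / k"
    proof (rule divide_right_mono)
      have "b\<^sup>2 = L\<^sup>2 * (f + 2 * r * x)\<^sup>2" by (simp add: b_def power_mult_distrib)
      also have "\<dots> \<le> L\<^sup>2 * (2 * f\<^sup>2 + 2 * (2 * r * x)\<^sup>2)"
        using sum_squares_bound[of f "2 * r * x"] by (intro mult_left_mono) (auto simp: power2_sum)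
      also have "2 * (2 * r * x)\<^sup>2 = 8 * (x\<^sup>2 * (p - a)\<^sup>2)" by (simp add: r_def power_mult_distrib)
      finally show "b\<^sup>2 \<le> L\<^sup>2 * (2 * f\<^sup>2 + 8 * (x\<^sup>2 * (p - a)\<^sup>2))" .
    qed (use k in simp)
    finally show ?thesis by (simp add: b_def algebra_simps)
  qed
  have "(1 + 2 * L * a) * y\<^sup>2 = (1 + 2 * L * p) * y\<^sup>2 + 2 * L * (a - p) * y\<^sup>2"
    by (simp add: algebra_simps)
  moreover have "(k - 1 + 2 * L * a) * d\<^sup>2 = k * d\<^sup>2 - d\<^sup>2 + 2 * L * a * d\<^sup>2"
    by (simp add: algebra_simps)
  ultimately show ?thesis using step 1 2 by linarith
qed

section \<open>Sums of inverse squares\<close>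

lemma inverse_squares_tail:
  assumes "n \<ge> 1"
  shows "summable (\<lambda>i. 1 / (real (i + n) + 1)\<^sup>2)" "(\<Sum>i. 1 / (real (i + n) + 1)\<^sup>2) \<le> 1 / real n"
proof -
  have "(\<lambda>i. 1 / real (i + n)) \<longlonglongrightarrow> 0"
    by (rule LIMSEQ_ignore_initial_segment[OF lim_1_over_n])
  from telescope_sums'[OF this]
  have t: "(\<lambda>i. 1 / real (i + n) - 1 / real (Suc i + n)) sums (1 / real n)" by simp
  have le: "1 / (real (i + n) + 1)\<^sup>2 \<le> 1 / real (i + n) - 1 / real (Suc i + n)" for i
  proof -
    define r where "r = real (i + n)"
    have "r > 0" using assms by (simp add: r_def)
    then have "1 / (r + 1)\<^sup>2 \<le> 1 / (r * (r + 1))"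
      by (intro divide_left_mono) (auto simp: power2_eq_square intro!: mult_right_mono)
    also have "\<dots> = 1 / r - 1 / (r + 1)" using \<open>r > 0\<close> by (simp add: field_simps)
    finally show ?thesis by (simp add: r_def add_ac)
  qed
  show s: "summable (\<lambda>i. 1 / (real (i + n) + 1)\<^sup>2)"
    by (rule summable_comparison_test'[OF sums_summable[OF t], of 0]) (use le in auto)
  show "(\<Sum>i. 1 / (real (i + n) + 1)\<^sup>2) \<le> 1 / real n"
    using suminf_le[OF le s sums_summable[OF t]] sums_unique[OF t] by simp
qed

text \<open>The exact value is pi^2 / 6 - 1, about 0.645. Telescoping accounts for 1/2, and the
  surplus terms \<open>1 / ((i + 2)^2 * (i + 3))\<close> for i < 4 add at least 1/8.\<close>

lemma inverse_squares_ge: "5 / 8 \<le> (\<Sum>i. 1 / (real i + 2)\<^sup>2)"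
proof -
  have "(\<lambda>i. 1 / (real i + 2)) \<longlonglongrightarrow> 0"
    using LIMSEQ_ignore_initial_segment[OF lim_1_over_n[where 'a = real], of 2] by (simp add: add.commute)
  from telescope_sums'[OF this]
  have t: "(\<lambda>i. 1 / (real i + 2) - 1 / (real i + 3)) sums (1 / 2)" by (simp add: add_ac)
  have s: "summable (\<lambda>i. 1 / (real i + 2)\<^sup>2)"
    using inverse_squares_tail(1)[of 1] by (simp add: add_ac)
  define f where "f i = 1 / (real i + 2)\<^sup>2 - (1 / (real i + 2) - 1 / (real i + 3))" for i :: nat
  have f: "f i \<ge> 0" for i
  proof -
    define r where "r = real i"
    have "r \<ge> 0" by (simp add: r_def)
    then have "1 / (r + 2)\<^sup>2 - (1 / (r + 2) - 1 / (r + 3)) = 1 / ((r + 2)\<^sup>2 * (r + 3))"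
      by (simp add: divide_simps) (simp add: power2_eq_square algebra_simps)
    then show ?thesis using \<open>r \<ge> 0\<close> by (simp add: f_def r_def)
  qed
  have fs: "summable f" unfolding f_def by (intro summable_diff s sums_summable[OF t])
  have "1 / 8 \<le> sum f {..<4}" by (simp add: f_def eval_nat_numeral)
  also have "\<dots> \<le> suminf f" using fs f by (intro sum_le_suminf) auto
  also have "\<dots> = (\<Sum>i. 1 / (real i + 2)\<^sup>2) - 1 / 2"
    unfolding f_def using suminf_diff[OF s sums_summable[OF t]] sums_unique[OF t] by simp
  finally show ?thesis by simp
qed

section \<open>Abstract stochastic descent and the maximal inequality\<close>

text \<open>The geometry is distilled into real processes: D is the distance to the zero, \<delta>
  the length of a step, and G a pairing bounded by \<Phi> times D. The second moment of \<delta> is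
  bounded as a nonnegative integral, which makes its finiteness part of the assumption.\<close>

locale stochastic_descent = prob_space P for P :: "'w measure" +
  fixes mu :: "'e measure" and \<xi> :: "nat \<Rightarrow> 'w \<Rightarrow> 'e"
    and \<alpha> \<Phi> :: "'e \<Rightarrow> real" and D \<delta> G :: "nat \<Rightarrow> 'w \<Rightarrow> real"
    and lam :: "nat \<Rightarrow> real" and \<sigma> :: real
  assumes prob_mu: "prob_space mu"
    and indep: "indep_vars (\<lambda>_. mu) \<xi> {1..}"
    and distr: "\<And>n. n \<ge> 1 \<Longrightarrow> distr P mu (\<xi> n) = mu"
    and \<alpha>_meas: "\<alpha> \<in> borel_measurable mu"
    and \<alpha>_range: "\<And>s. s \<in> space mu \<Longrightarrow> 0 < \<alpha> s \<and> \<alpha> s \<le> 1"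
    and \<Phi>_meas: "\<Phi> \<in> borel_measurable mu"
    and \<Phi>_sq: "integrable mu (\<lambda>s. (\<Phi> s)\<^sup>2)"
    and \<Phi>_nonneg: "\<And>s. s \<in> space mu \<Longrightarrow> \<Phi> s \<ge> 0"
    and D_meas: "\<And>n. D n \<in> borel_measurable (nat_filtration P mu \<xi> n)"
    and D_nonneg: "\<And>n w. D n w \<ge> 0"
    and D_0: "integrable P (\<lambda>w. (D 0 w)\<^sup>2)"
    and \<delta>_meas: "\<And>n. \<delta> n \<in> borel_measurable P"
    and \<delta>_nonneg: "\<And>n w. \<delta> n w \<ge> 0"
    and \<delta>_sq: "\<And>n. (\<integral>\<^sup>+w. ennreal ((\<delta> n w)\<^sup>2) \<partial>P) \<le> ennreal ((lam n)\<^sup>2 * \<sigma>)"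
    and \<sigma>_nonneg: "\<sigma> \<ge> 0"
    and G_meas: "\<And>n. G n \<in> borel_measurable P"
    and G_le: "\<And>n w. w \<in> space P \<Longrightarrow> \<bar>G n w\<bar> \<le> \<Phi> (\<xi> (Suc n) w) * D n w"
    and G_cond: "\<And>n. AE w in P. real_cond_exp P (nat_filtration P mu \<xi> n) (G n) w = 0"
    and lam_pos: "\<And>n. lam n > 0"
    and step: "\<And>n w. w \<in> space P \<Longrightarrow> (1 + 2 * lam n * \<alpha> (\<xi> (Suc n) w)) * (D (Suc n) w)\<^sup>2 \<le>
      (D n w)\<^sup>2 - 2 * lam n * G n w - (\<delta> n w)\<^sup>2 + 2 * lam n * \<Phi> (\<xi> (Suc n) w) * \<delta> n w"
    and D_diff: "\<And>n w. w \<in> space P \<Longrightarrow> \<bar>D (Suc n) w - D n w\<bar> \<le> \<delta> n w"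
begin

abbreviation F where "F n \<equiv> nat_filtration P mu \<xi> n"

definition C where "C = (\<integral>s. (\<Phi> s)\<^sup>2 \<partial>mu)"

lemma \<xi>_meas: "i \<ge> 1 \<Longrightarrow> \<xi> i \<in> measurable P mu"
  using indep unfolding indep_vars_def2 by auto

lemma subalg: "subalgebra P (F n)"
  by (intro subalgebra_nat_filtration \<xi>_meas)

lemma \<xi>_space: "w \<in> space P \<Longrightarrow> \<xi> (Suc n) w \<in> space mu"
  using measurable_space[OF \<xi>_meas[of "Suc n"]] by simp

lemma expect_\<xi>:
  fixes h :: "'e \<Rightarrow> real"
  assumes "integrable mu h"
  shows "integrable P (\<lambda>w. h (\<xi> (Suc n) w))" "(\<integral>w. h (\<xi> (Suc n) w) \<partial>P) = (\<integral>s. h s \<partial>mu)"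
proof -
  have x: "\<xi> (Suc n) \<in> measurable P mu" and d: "distr P mu (\<xi> (Suc n)) = mu"
    by (simp_all add: \<xi>_meas distr)
  show "integrable P (\<lambda>w. h (\<xi> (Suc n) w))"
    using integrable_distr_eq[OF x, of h] assms d by auto
  show "(\<integral>w. h (\<xi> (Suc n) w) \<partial>P) = (\<integral>s. h s \<partial>mu)"
    using integral_distr[OF x, of h] assms d by auto
qed

lemma expect_mult:
  fixes f :: "'w \<Rightarrow> real" and h :: "'e \<Rightarrow> real"
  assumes "f \<in> borel_measurable (F n)" "integrable P f" "integrable mu h"
  shows "integrable P (\<lambda>w. f w * h (\<xi> (Suc n) w))"
    "(\<integral>w. f w * h (\<xi> (Suc n) w) \<partial>P) = (\<integral>w. f w \<partial>P) * (\<integral>s. h s \<partial>mu)"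
proof -
  have i: "indep_var borel f borel (\<lambda>w. h (\<xi> (Suc n) w))"
    by (rule indep_nat_filtration[OF indep assms(1)]) (use assms(3) in auto)
  show "integrable P (\<lambda>w. f w * h (\<xi> (Suc n) w))"
    by (rule indep_var_integrable[OF i assms(2) expect_\<xi>(1)[OF assms(3)]])
  show "(\<integral>w. f w * h (\<xi> (Suc n) w) \<partial>P) = (\<integral>w. f w \<partial>P) * (\<integral>s. h s \<partial>mu)"
    using indep_var_lebesgue_integral[OF i assms(2) expect_\<xi>(1)[OF assms(3)]]
      expect_\<xi>(2)[OF assms(3)] by simp
qed

lemma D_meas_P: "D n \<in> borel_measurable P"
  by (rule measurable_from_subalg[OF subalg D_meas])

lemma \<delta>_integrable: "integrable P (\<lambda>w. (\<delta> n w)\<^sup>2)"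
  and \<delta>_integral: "(\<integral>w. (\<delta> n w)\<^sup>2 \<partial>P) \<le> (lam n)\<^sup>2 * \<sigma>"
proof -
  note [measurable] = \<delta>_meas
  show i: "integrable P (\<lambda>w. (\<delta> n w)\<^sup>2)"
    by (rule integrableI_nonneg) (use \<delta>_sq[of n] in \<open>auto simp: less_top[symmetric] top_unique\<close>)
  have "ennreal (\<integral>w. (\<delta> n w)\<^sup>2 \<partial>P) \<le> ennreal ((lam n)\<^sup>2 * \<sigma>)"
    using \<delta>_sq[of n] nn_integral_eq_integral[OF i] by simp
  then show "(\<integral>w. (\<delta> n w)\<^sup>2 \<partial>P) \<le> (lam n)\<^sup>2 * \<sigma>"
    using \<sigma>_nonneg by (simp add: ennreal_le_iff)
qed

lemma D_sq_integrable: "integrable P (\<lambda>w. (D n w)\<^sup>2)"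
proof (induction n)
  case 0
  show ?case by (rule D_0)
next
  case (Suc n)
  note [measurable] = D_meas_P
  have "integrable P (\<lambda>w. 2 * (D n w)\<^sup>2 + 2 * (\<delta> n w)\<^sup>2)"
    using Suc \<delta>_integrable[of n] by simp
  then show ?case
  proof (rule Bochner_Integration.integrable_bound)
    have "(D (Suc n) w)\<^sup>2 \<le> 2 * (D n w)\<^sup>2 + 2 * (\<delta> n w)\<^sup>2" if "w \<in> space P" for w
    proof -
      have "D (Suc n) w \<le> D n w + \<delta> n w" using D_diff[OF that, of n] by linarith
      then have "(D (Suc n) w)\<^sup>2 \<le> (D n w + \<delta> n w)\<^sup>2" by (intro power_mono D_nonneg)
      then show ?thesis using sum_squares_bound[of "D n w" "\<delta> n w"] by (simp add: power2_sum)
    qed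
    then show "AE w in P. norm ((D (Suc n) w)\<^sup>2) \<le> norm (2 * (D n w)\<^sup>2 + 2 * (\<delta> n w)\<^sup>2)"
      by (intro AE_I2) auto
  qed measurable
qed

lemma G_integrable: "integrable P (G n)"
proof -
  note [measurable] = D_meas_P G_meas \<Phi>_meas
  interpret mu: prob_space mu by (rule prob_mu)
  have "integrable P (D n)"
    by (rule square_integrable_imp_integrable) (simp_all add: D_sq_integrable)
  moreover have "integrable mu \<Phi>"
    by (rule mu.square_integrable_imp_integrable) (simp_all add: \<Phi>_sq)
  ultimately have "integrable P (\<lambda>w. D n w * \<Phi> (\<xi> (Suc n) w))"
    by (intro expect_mult D_meas)
  then show ?thesis
    by (rule Bochner_Integration.integrable_bound)
      (use G_le D_nonneg \<Phi>_nonneg[OF \<xi>_space] in \<open>auto simp: mult.commute abs_mult\<close>)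
qed

text \<open>The vanishing conditional mean in the form in which it is used: tested on events of the
  past.\<close>

lemma G_set_integral:
  assumes "B \<in> sets (F n)"
  shows "(\<integral>w. indicator B w * G n w \<partial>P) = 0"
proof -
  interpret finite_measure_subalgebra P "F n"
    by (unfold_locales) (rule subalg)
  have "(\<integral>w. indicator B w * G n w \<partial>P) = (\<integral>w\<in>B. real_cond_exp P (F n) (G n) w \<partial>P)"
    using real_cond_exp_intA[OF G_integrable assms] by (simp add: set_lebesgue_integral_def)
  also have "\<dots> = (\<integral>w. 0 \<partial>P)"
    unfolding set_lebesgue_integral_def
  proof (rule integral_cong_AE)
    have "B \<in> sets P" using assms subalg by (auto simp: subalgebra_def)
    then show "(\<lambda>w. indicator B w *\<^sub>R real_cond_exp P (F n) (G n) w) \<in> borel_measurable P"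
      by measurable
  qed (use G_cond[of n] in auto)
  finally show ?thesis by simp
qed

lemma G_integral: "(\<integral>w. G n w \<partial>P) = 0"
  using G_set_integral[of "space P" n] sets.top[of "F n"] by (simp cong: Bochner_Integration.integral_cong)

text \<open>The supermartingale inequality integrated over an event of the past, as the stopping
  argument requires. Young's inequality with weight one makes \<open>- \<delta>^2\<close> cancel
  exactly.\<close>

lemma step_set_integral:
  assumes B: "B \<in> sets (F n)"
  shows "(\<integral>w. indicator B w * (D (Suc n) w)\<^sup>2 \<partial>P) \<le>
    (\<integral>w. indicator B w * (D n w)\<^sup>2 \<partial>P) + (lam n)\<^sup>2 * C"
proof -
  have BP: "B \<in> sets P" using B subalg by (auto simp: subalgebra_def)
  note ind = integrable_real_mult_indicator[OF BP]
  have i1: "integrable P (\<lambda>w. indicator B w * (D (Suc n) w)\<^sup>2)"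
    and i2: "integrable P (\<lambda>w. indicator B w * (D n w)\<^sup>2)"
    and i3: "integrable P (\<lambda>w. indicator B w * G n w)"
    using ind[OF D_sq_integrable[of "Suc n"]] ind[OF D_sq_integrable[of n]] ind[OF G_integrable[of n]]
    by (simp_all add: mult.commute)
  have i4: "integrable P (\<lambda>w. (\<Phi> (\<xi> (Suc n) w))\<^sup>2)" by (rule expect_\<xi>[OF \<Phi>_sq])
  have "(\<integral>w. indicator B w * (D (Suc n) w)\<^sup>2 \<partial>P) \<le>
    (\<integral>w. indicator B w * (D n w)\<^sup>2 - 2 * lam n * (indicator B w * G n w) + (lam n)\<^sup>2 * (\<Phi> (\<xi> (Suc n) w))\<^sup>2 \<partial>P)"
  proof (rule integral_mono)
    fix w assume w: "w \<in> space P"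
    have "0 \<le> 2 * lam n * \<alpha> (\<xi> (Suc n) w) * (D (Suc n) w)\<^sup>2"
      using lam_pos[of n] \<alpha>_range[OF \<xi>_space[OF w, of n]] by (intro mult_nonneg_nonneg) auto
    then have "(D (Suc n) w)\<^sup>2 \<le> (1 + 2 * lam n * \<alpha> (\<xi> (Suc n) w)) * (D (Suc n) w)\<^sup>2"
      by (simp add: distrib_right)
    also note step[OF w, of n]
    also have "2 * lam n * \<Phi> (\<xi> (Suc n) w) * \<delta> n w \<le> (lam n * \<Phi> (\<xi> (Suc n) w))\<^sup>2 + (\<delta> n w)\<^sup>2"
      using sum_squares_bound[of "lam n * \<Phi> (\<xi> (Suc n) w)" "\<delta> n w"] by (simp add: mult_ac)
    finally have "(D (Suc n) w)\<^sup>2 \<le> (D n w)\<^sup>2 - 2 * lam n * G n w + (lam n)\<^sup>2 * (\<Phi> (\<xi> (Suc n) w))\<^sup>2"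
      by (simp add: power_mult_distrib)
    then show "indicator B w * (D (Suc n) w)\<^sup>2 \<le> indicator B w * (D n w)\<^sup>2 -
        2 * lam n * (indicator B w * G n w) + (lam n)\<^sup>2 * (\<Phi> (\<xi> (Suc n) w))\<^sup>2"
      by (auto simp: indicator_def)
  qed (use i1 i2 i3 i4 in auto)
  also have "\<dots> = (\<integral>w. indicator B w * (D n w)\<^sup>2 \<partial>P) + (lam n)\<^sup>2 * C"
    using i2 i3 i4 G_set_integral[OF B] expect_\<xi>(2)[OF \<Phi>_sq] by (simp add: C_def)
  finally show ?thesis .
qed

lemma C_nonneg: "C \<ge> 0"
  unfolding C_def by simp

lemma D_sq_step: "(\<integral>w. (D (Suc n) w)\<^sup>2 \<partial>P) \<le> (\<integral>w. (D n w)\<^sup>2 \<partial>P) + (lam n)\<^sup>2 * C"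
  using step_set_integral[of "space P" n] sets.top[of "F n"]
  by (simp cong: Bochner_Integration.integral_cong)

lemma D_sq_sum: "(\<integral>w. (D n w)\<^sup>2 \<partial>P) \<le> (\<integral>w. (D 0 w)\<^sup>2 \<partial>P) + C * (\<Sum>i<n. (lam i)\<^sup>2)"
proof (induction n)
  case (Suc n)
  then show ?case using D_sq_step[of n] by (simp add: algebra_simps)
qed simp

text \<open>Ville's inequality for the supermartingale with terms D_k^2 + C * sum_{i>=k} lam_i^2, over a
  finite horizon: D is stopped at the first exceedance of the threshold.\<close>

lemma maximal_finite:
  assumes eps: "\<epsilon> > 0"
  shows "\<epsilon> * prob {w\<in>space P. \<exists>m\<in>{n..n + j}. (D m w)\<^sup>2 \<ge> \<epsilon>}
    \<le> (\<integral>w. (D n w)\<^sup>2 \<partial>P) + C * (\<Sum>i\<in>{n..<n + j}. (lam i)\<^sup>2)"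
proof -
  define B where "B k = {w\<in>space P. \<forall>m\<in>{n..k}. (D m w)\<^sup>2 < \<epsilon>}" for k
  \<comment> \<open>After an exceedance Z is frozen at \<epsilon> and not at the overshooting value
    of D^2. This only lowers Z, and makes it constant off \<open>B k\<close>, an event known at time
    k.\<close>
  define Z where "Z k w = (if w \<in> B k then (D k w)\<^sup>2 else \<epsilon>)" for k w
  have B: "B k \<in> sets (F k)" for k
  proof -
    have [measurable]: "D m \<in> borel_measurable (F k)" if "m \<in> {n..k}" for m
      using that by (auto intro: measurable_nat_filtration_mono[OF D_meas])
    have "B k = {w\<in>space (F k). \<forall>m\<in>{n..k}. (D m w)\<^sup>2 < \<epsilon>}" by (simp add: B_def)
    also have "\<dots> \<in> sets (F k)" by measurable
    finally show ?thesis .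
  qed
  have BP: "B k \<in> sets P" for k using B[of k] subalg[of k] by (auto simp: subalgebra_def)
  note [measurable] = BP D_meas_P
  have Z: "Z k w = indicator (B k) w * (D k w)\<^sup>2 + \<epsilon> * indicator (space P - B k) w" if "w \<in> space P" for k w
    using that by (simp add: Z_def indicator_def)
  have i1: "integrable P (\<lambda>w. indicator (B k) w * (D m w)\<^sup>2)" for k m
    using integrable_real_mult_indicator[OF BP D_sq_integrable] by (simp add: mult.commute)
  have i2: "integrable P (\<lambda>w. \<epsilon> * indicator (space P - B k) w :: real)" for k
    by (intro integrable_mult_right integrable_real_indicator) (auto simp: emeasure_eq_measure)
  have iZ: "integrable P (Z k)" for k
    using Bochner_Integration.integrable_add[OF i1[of k k] i2[of k]]
    by (rule Bochner_Integration.integrable_cong[THEN iffD2, rotated -1]) (auto simp: Z)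
  have "(\<integral>w. Z (n + j) w \<partial>P) \<le> (\<integral>w. (D n w)\<^sup>2 \<partial>P) + C * (\<Sum>i\<in>{n..<n + j}. (lam i)\<^sup>2)"
  proof (induction j)
    case 0
    have "(\<integral>w. Z n w \<partial>P) \<le> (\<integral>w. (D n w)\<^sup>2 \<partial>P)"
      by (rule integral_mono[OF iZ D_sq_integrable]) (auto simp: Z_def B_def)
    then show ?case by simp
  next
    case (Suc j)
    define k where "k = n + j"
    have "(\<integral>w. Z (Suc k) w \<partial>P) \<le>
        (\<integral>w. indicator (B k) w * (D (Suc k) w)\<^sup>2 + \<epsilon> * indicator (space P - B k) w \<partial>P)"
    proof (rule integral_mono[OF iZ Bochner_Integration.integrable_add[OF i1 i2]])
      fix w assume w: "w \<in> space P"
      have "{n..Suc k} = insert (Suc k) {n..k}" by (auto simp: k_def)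
      then have "w \<in> B (Suc k) \<longleftrightarrow> w \<in> B k \<and> (D (Suc k) w)\<^sup>2 < \<epsilon>" by (auto simp: B_def)
      then show "Z (Suc k) w \<le> indicator (B k) w * (D (Suc k) w)\<^sup>2 + \<epsilon> * indicator (space P - B k) w"
        using w by (cases "w \<in> B k") (auto simp: Z_def)
    qed
    also have "\<dots> = (\<integral>w. indicator (B k) w * (D (Suc k) w)\<^sup>2 \<partial>P) + (\<integral>w. \<epsilon> * indicator (space P - B k) w \<partial>P)"
      by (rule Bochner_Integration.integral_add[OF i1 i2])
    also have "\<dots> \<le> (\<integral>w. indicator (B k) w * (D k w)\<^sup>2 \<partial>P) + (lam k)\<^sup>2 * C + (\<integral>w. \<epsilon> * indicator (space P - B k) w \<partial>P)"
      using step_set_integral[OF B[of k]] by simp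
    also have "\<dots> = (\<integral>w. indicator (B k) w * (D k w)\<^sup>2 + \<epsilon> * indicator (space P - B k) w \<partial>P) + (lam k)\<^sup>2 * C"
      by (subst Bochner_Integration.integral_add[OF i1 i2]) simp
    also have "\<dots> = (\<integral>w. Z k w \<partial>P) + (lam k)\<^sup>2 * C"
      using Z by (simp cong: Bochner_Integration.integral_cong)
    finally show ?case using Suc by (simp add: k_def algebra_simps)
  qed
  moreover have "\<epsilon> * prob (space P - B (n + j)) \<le> (\<integral>w. Z (n + j) w \<partial>P)"
  proof -
    have "(\<integral>w. \<epsilon> * indicator (space P - B (n + j)) w \<partial>P) \<le> (\<integral>w. Z (n + j) w \<partial>P)"
      by (rule integral_mono[OF i2 iZ]) (auto simp: Z_def)
    then show ?thesis by simp
  qed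
  moreover have "space P - B (n + j) = {w\<in>space P. \<exists>m\<in>{n..n + j}. (D m w)\<^sup>2 \<ge> \<epsilon>}"
    by (auto simp: B_def not_less)
  ultimately show ?thesis by simp
qed

lemma maximal_inequality:
  assumes eps: "\<epsilon> > 0" and lam: "summable (\<lambda>i. (lam i)\<^sup>2)"
  shows "\<epsilon> * prob {w\<in>space P. \<exists>m\<ge>n. (D m w)\<^sup>2 \<ge> \<epsilon>}
    \<le> (\<integral>w. (D n w)\<^sup>2 \<partial>P) + C * (\<Sum>i. (lam (i + n))\<^sup>2)"
proof -
  note [measurable] = D_meas_P
  define E where "E j = {w\<in>space P. \<exists>m\<in>{n..n + j}. (D m w)\<^sup>2 \<ge> \<epsilon>}" for j
  have E: "range E \<subseteq> sets P" unfolding E_def by auto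
  have "incseq E" by (auto simp: incseq_def E_def intro: order_trans)
  from finite_Lim_measure_incseq[OF E this]
  have "(\<lambda>j. \<epsilon> * prob (E j)) \<longlonglongrightarrow> \<epsilon> * prob (\<Union>j. E j)" by (intro tendsto_intros)
  moreover have "\<epsilon> * prob (E j) \<le> (\<integral>w. (D n w)\<^sup>2 \<partial>P) + C * (\<Sum>i. (lam (i + n))\<^sup>2)" for j
  proof -
    have "(\<Sum>i\<in>{n..<n + j}. (lam i)\<^sup>2) = (\<Sum>i<j. (lam (i + n))\<^sup>2)"
      using sum.shift_bounds_nat_ivl[of "\<lambda>i. (lam i)\<^sup>2" 0 n j] by (simp add: add.commute lessThan_atLeast0)
    also have "\<dots> \<le> (\<Sum>i. (lam (i + n))\<^sup>2)"
      using lam by (intro sum_le_suminf summable_ignore_initial_segment) auto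
    finally have "C * (\<Sum>i\<in>{n..<n + j}. (lam i)\<^sup>2) \<le> C * (\<Sum>i. (lam (i + n))\<^sup>2)"
      using C_nonneg by (intro mult_left_mono)
    then show ?thesis using maximal_finite[OF eps, of n j] by (simp add: E_def)
  qed
  ultimately have "\<epsilon> * prob (\<Union>j. E j) \<le> (\<integral>w. (D n w)\<^sup>2 \<partial>P) + C * (\<Sum>i. (lam (i + n))\<^sup>2)"
    by (intro LIMSEQ_le_const2) auto
  moreover have "(\<Union>j. E j) = {w\<in>space P. \<exists>m\<ge>n. (D m w)\<^sup>2 \<ge> \<epsilon>}"
  proof -
    have "\<exists>j. m \<in> {n..n + j}" if "m \<ge> n" for m using that by (intro exI[of _ "m - n"]) auto
    then show ?thesis unfolding E_def by fastforce
  qed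
  ultimately show ?thesis by simp
qed

section \<open>Strong monotonicity in the mean\<close>

definition a where "a = (\<integral>s. \<alpha> s \<partial>mu)"

lemma \<alpha>_integrable: "integrable mu \<alpha>"
proof -
  interpret mu: prob_space mu by (rule prob_mu)
  show ?thesis
    by (rule mu.integrable_const_bound[of _ 1]) (use \<alpha>_range \<alpha>_meas in \<open>force+\<close>)
qed

lemma \<alpha>_sq_integrable: "integrable mu (\<lambda>s. (\<alpha> s)\<^sup>2)"
proof -
  interpret mu: prob_space mu by (rule prob_mu)
  note [measurable] = \<alpha>_meas
  have "norm ((\<alpha> s)\<^sup>2) \<le> 1" if "s \<in> space mu" for s
    using \<alpha>_range[OF that] by (simp add: power_le_one)
  then show ?thesis
    by (intro mu.integrable_const_bound[of _ 1]) auto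
qed

lemma a_le_1: "a \<le> 1"
proof -
  interpret mu: prob_space mu by (rule prob_mu)
  have "a \<le> (\<integral>s. 1 \<partial>mu)"
    unfolding a_def by (rule integral_mono[OF \<alpha>_integrable]) (use \<alpha>_range in auto)
  then show ?thesis by (simp add: mu.prob_space)
qed

lemma a_nonneg: "0 \<le> a"
  unfolding a_def by (rule Bochner_Integration.integral_nonneg_AE) (use \<alpha>_range in \<open>force intro: AE_I2\<close>)

text \<open>From \<alpha> <= 1 follows \<alpha>^2 <= \<alpha>, so the variance is controlled by the
  mean and contributes no further parameter to the rate.\<close>

lemma \<alpha>_variance:
  "integrable mu (\<lambda>s. (\<alpha> s - a)\<^sup>2)" "(\<integral>s. (\<alpha> s - a)\<^sup>2 \<partial>mu) \<le> a - a\<^sup>2"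
proof -
  interpret mu: prob_space mu by (rule prob_mu)
  have eq: "(\<lambda>s. (\<alpha> s - a)\<^sup>2) = (\<lambda>s. (\<alpha> s)\<^sup>2 - 2 * a * \<alpha> s + a\<^sup>2)"
    by (auto simp: power2_diff)
  show "integrable mu (\<lambda>s. (\<alpha> s - a)\<^sup>2)"
    unfolding eq using \<alpha>_integrable \<alpha>_sq_integrable by simp
  have "(\<integral>s. (\<alpha> s - a)\<^sup>2 \<partial>mu) = (\<integral>s. (\<alpha> s)\<^sup>2 \<partial>mu) - a\<^sup>2"
    unfolding eq using \<alpha>_integrable \<alpha>_sq_integrable a_def
    by (simp add: mu.prob_space power2_eq_square)
  moreover have "(\<integral>s. (\<alpha> s)\<^sup>2 \<partial>mu) \<le> a"
    unfolding a_def
    by (rule integral_mono[OF \<alpha>_sq_integrable \<alpha>_integrable])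
      (use \<alpha>_range in \<open>force simp: power2_eq_square mult_left_le\<close>)
  ultimately show "(\<integral>s. (\<alpha> s - a)\<^sup>2 \<partial>mu) \<le> a - a\<^sup>2" by simp
qed

lemma strong_step_integral:
  assumes k: "k \<ge> 1"
  shows "(1 + 2 * lam n * a) * (\<integral>w. (D (Suc n) w)\<^sup>2 \<partial>P) \<le> (\<integral>w. (D n w)\<^sup>2 \<partial>P) +
    (lam n)\<^sup>2 * ((k - 1 + 2 * lam n * a) * \<sigma> + (2 * C + 8 * (a - a\<^sup>2) * (\<integral>w. (D n w)\<^sup>2 \<partial>P)) / k)"
proof -
  interpret mu: prob_space mu by (rule prob_mu)
  let ?e = "\<integral>w. (D n w)\<^sup>2 \<partial>P"
  let ?v = "\<integral>s. (\<alpha> s - a)\<^sup>2 \<partial>mu"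
  have D2: "(\<lambda>w. (D n w)\<^sup>2) \<in> borel_measurable (F n)" using D_meas[of n] by measurable
  have h1: "integrable mu (\<lambda>s. a - \<alpha> s)" using \<alpha>_integrable by simp
  \<comment> \<open>\<open>D n\<close> depends on the past alone, so its products with functions of
    the new sample factorize. By \<open>z\<close> the term of first order in \<alpha> vanishes and
    only the variance is left.\<close>
  note m1 = expect_mult[OF D2 D_sq_integrable h1]
  note m2 = expect_mult[OF D2 D_sq_integrable \<alpha>_variance(1)]
  note m3 = expect_\<xi>[OF \<Phi>_sq, of n]
  have z: "(\<integral>s. a - \<alpha> s \<partial>mu) = 0" using \<alpha>_integrable by (simp add: mu.prob_space a_def)
  have "(1 + 2 * lam n * a) * (\<integral>w. (D (Suc n) w)\<^sup>2 \<partial>P) = (\<integral>w. (1 + 2 * lam n * a) * (D (Suc n) w)\<^sup>2 \<partial>P)"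
    by simp
  also have "\<dots> \<le> (\<integral>w. (D n w)\<^sup>2 - 2 * lam n * G n w + 2 * lam n * ((D n w)\<^sup>2 * (a - \<alpha> (\<xi> (Suc n) w))) +
    (k - 1 + 2 * lam n * a) * (\<delta> n w)\<^sup>2 +
    (lam n)\<^sup>2 * (2 * (\<Phi> (\<xi> (Suc n) w))\<^sup>2 + 8 * ((D n w)\<^sup>2 * (\<alpha> (\<xi> (Suc n) w) - a)\<^sup>2)) / k \<partial>P)"
  proof (rule integral_mono)
    fix w assume w: "w \<in> space P"
    show "(1 + 2 * lam n * a) * (D (Suc n) w)\<^sup>2 \<le>
      (D n w)\<^sup>2 - 2 * lam n * G n w + 2 * lam n * ((D n w)\<^sup>2 * (a - \<alpha> (\<xi> (Suc n) w))) +
      (k - 1 + 2 * lam n * a) * (\<delta> n w)\<^sup>2 +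
      (lam n)\<^sup>2 * (2 * (\<Phi> (\<xi> (Suc n) w))\<^sup>2 + 8 * ((D n w)\<^sup>2 * (\<alpha> (\<xi> (Suc n) w) - a)\<^sup>2)) / k"
      using strong_step_pointwise[OF step[OF w, of n] D_diff[OF w] D_nonneg D_nonneg _ a_nonneg _ k]
        lam_pos[of n] \<alpha>_range[OF \<xi>_space[OF w, of n]] by simp
  qed (use D_sq_integrable G_integrable \<delta>_integrable m1(1) m2(1) m3(1) in auto)
  also have "\<dots> = ?e + (k - 1 + 2 * lam n * a) * (\<integral>w. (\<delta> n w)\<^sup>2 \<partial>P) + (lam n)\<^sup>2 * (2 * C + 8 * (?e * ?v)) / k"
    using D_sq_integrable G_integrable \<delta>_integrable m1 m2 m3 z G_integral by (simp add: C_def)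
  \<comment> \<open>The bound on the second moment of \<delta> is inserted under a nonnegative
    coefficient, which is what \<open>k >= 1\<close> guarantees.\<close>
  also have "\<dots> \<le> ?e + (k - 1 + 2 * lam n * a) * ((lam n)\<^sup>2 * \<sigma>) + (lam n)\<^sup>2 * (2 * C + 8 * (?e * (a - a\<^sup>2))) / k"
    using k a_nonneg lam_pos[of n] \<delta>_integral \<alpha>_variance(2)
    by (intro add_mono mult_mono mult_left_mono divide_right_mono) auto
  also have "\<dots> = ?e + (lam n)\<^sup>2 * ((k - 1 + 2 * lam n * a) * \<sigma> + (2 * C + 8 * (a - a\<^sup>2) * ?e) / k)"
    by (simp add: field_simps)
  finally show ?thesis .
qed

section \<open>Explicit step sizes and constants\<close>

context
  fixes c b \<Lambda> u :: real
  assumes a_pos: "a > 0" and lam: "\<And>n. lam n = 1 / (a * (real n + 2))"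
    and \<Lambda>: "(\<Sum>n. (lam n)\<^sup>2) < \<Lambda>"
    and c: "C < c" and b: "(\<integral>w. (D 0 w)\<^sup>2 \<partial>P) \<le> b"
    and u: "u = max (4 * \<sigma> + 2 * c) (real_of_int \<lceil>4 / a\<^sup>2\<rceil> * (b + c * \<Lambda>))"
begin

lemma c_pos: "c > 0" using c C_nonneg by linarith

text \<open>The offset n + 2 is split as \<open>(n + 1) + 1\<close> to fit
  \<open>inverse_squares_tail\<close>, whose lower bound on the index then holds for every
  n.\<close>

lemma lam_sq: "(lam (i + n))\<^sup>2 = 1 / a\<^sup>2 * (1 / (real (i + (n + 1)) + 1)\<^sup>2)"
  unfolding lam by (simp add: power_divide power_mult_distrib add_ac)

lemma lam_summable: "summable (\<lambda>i. (lam i)\<^sup>2)"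
  using summable_mult[OF inverse_squares_tail(1)[of 1], of "1 / a\<^sup>2"] lam_sq[of _ 0] by simp

lemma lam_tail: "(\<Sum>i. (lam (i + n))\<^sup>2) \<le> 1 / a\<^sup>2 * (2 / (real n + 2))"
proof -
  have "(\<Sum>i. (lam (i + n))\<^sup>2) = 1 / a\<^sup>2 * (\<Sum>i. 1 / (real (i + (n + 1)) + 1)\<^sup>2)"
    unfolding lam_sq by (rule suminf_mult[OF inverse_squares_tail(1)]) simp
  also have "\<dots> \<le> 1 / a\<^sup>2 * (1 / real (n + 1))"
    by (intro mult_left_mono inverse_squares_tail(2)) auto
  also have "\<dots> \<le> 1 / a\<^sup>2 * (2 / (real n + 2))"
    by (intro mult_left_mono) (auto simp: divide_simps)
  finally show ?thesis .
qed

text \<open>\<Lambda> is introduced as an upper bound of the series, yet u owes its size to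
  \<Lambda>; a lower estimate is what makes c small compared with u.\<close>

lemma \<Lambda>_ge: "5 / 8 / a\<^sup>2 \<le> \<Lambda>"
proof -
  have "5 / 8 / a\<^sup>2 \<le> 1 / a\<^sup>2 * (\<Sum>i. 1 / (real i + 2)\<^sup>2)"
    using divide_right_mono[OF inverse_squares_ge, of "a\<^sup>2"] by simp
  also have "\<dots> = (\<Sum>i. 1 / a\<^sup>2 * (1 / (real i + 2)\<^sup>2))"
    using inverse_squares_tail(1)[of 1] by (intro suminf_mult[symmetric]) (simp add: add_ac)
  also have "\<dots> = (\<Sum>i. (lam i)\<^sup>2)"
    using lam_sq[of _ 0] by (simp add: add_ac)
  finally show ?thesis using \<Lambda> by simp
qed

lemma \<Lambda>_pos: "\<Lambda> > 0"
proof -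
  have "5 / 8 / a\<^sup>2 > 0" using a_pos by simp
  then show ?thesis using \<Lambda>_ge by linarith
qed

lemma b_nonneg: "b \<ge> 0"
proof -
  have "0 \<le> (\<integral>w. (D 0 w)\<^sup>2 \<partial>P)" by simp
  then show ?thesis using b by linarith
qed

text \<open>From the second entry of u with b dropped: \<open>4 / a^2\<close> from the ceiling times
  \<open>5 / 8 / a^2\<close> from \<Lambda> is \<open>5 / 2 / a^4\<close>.\<close>

lemma c_le: "c \<le> 2 / 5 * a^4 * u"
proof -
  have "4 / a\<^sup>2 * (c * (5 / 8 / a\<^sup>2)) \<le> real_of_int \<lceil>4 / a\<^sup>2\<rceil> * (b + c * \<Lambda>)"
  proof (rule mult_mono)
    have "c * (5 / 8 / a\<^sup>2) \<le> c * \<Lambda>" using \<Lambda>_ge c_pos by (intro mult_left_mono) auto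
    then show "c * (5 / 8 / a\<^sup>2) \<le> b + c * \<Lambda>" using b_nonneg by linarith
  next
    have "0 \<le> 4 / a\<^sup>2" by simp
    then show "0 \<le> real_of_int \<lceil>4 / a\<^sup>2\<rceil>" by linarith
  qed (use c_pos in auto)
  then have "5 / 2 * c / a^4 \<le> u"
    using a_pos by (simp add: u power2_eq_square power4_eq_xxxx)
  then show ?thesis using a_pos by (simp add: divide_le_eq mult_ac)
qed

theorem mean_square_bound: "(\<integral>w. (D n w)\<^sup>2 \<partial>P) \<le> u / (real n + 2)"
proof -
  have early: "(\<integral>w. (D n w)\<^sup>2 \<partial>P) \<le> u / (real n + 2)" if "real n + 2 \<le> real_of_int \<lceil>4 / a\<^sup>2\<rceil>" for n
  proof -
    have "(\<Sum>i<n. (lam i)\<^sup>2) \<le> (\<Sum>i. (lam i)\<^sup>2)"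
      by (intro sum_le_suminf lam_summable) auto
    then have "C * (\<Sum>i<n. (lam i)\<^sup>2) \<le> c * \<Lambda>"
      using c C_nonneg \<Lambda> by (intro mult_mono) (auto intro: sum_nonneg)
    then have e: "(\<integral>w. (D n w)\<^sup>2 \<partial>P) \<le> b + c * \<Lambda>"
      using D_sq_sum[of n] b by linarith
    have "(real n + 2) * (b + c * \<Lambda>) \<le> real_of_int \<lceil>4 / a\<^sup>2\<rceil> * (b + c * \<Lambda>)"
      using that b_nonneg c_pos \<Lambda>_pos by (intro mult_right_mono) auto
    then have "(real n + 2) * (b + c * \<Lambda>) \<le> u" unfolding u by linarith
    moreover have "(real n + 2) * (\<integral>w. (D n w)\<^sup>2 \<partial>P) \<le> (real n + 2) * (b + c * \<Lambda>)"
      using e by (intro mult_left_mono) auto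
    ultimately have "(real n + 2) * (\<integral>w. (D n w)\<^sup>2 \<partial>P) \<le> u" by linarith
    then show ?thesis by (simp add: le_divide_eq mult.commute)
  qed
  have "a\<^sup>2 \<le> 1" using a_le_1 a_pos by (intro power_le_one) auto
  \<comment> \<open>The ceiling is thus at least 4, so index 0 lies in the early phase and the
    induction can start there.\<close>
  then have "4 / a\<^sup>2 \<ge> 4" using a_pos by (simp add: le_divide_eq)
  then have zero: "(\<integral>w. (D 0 w)\<^sup>2 \<partial>P) \<le> u / (real 0 + 2)"
    by (intro early) linarith
  have "(\<integral>w. (D (Suc n) w)\<^sup>2 \<partial>P) \<le> u / (real (Suc n) + 2)"
    if IH: "(\<integral>w. (D n w)\<^sup>2 \<partial>P) \<le> u / (real n + 2)" for n
  proof (cases "real (Suc n) + 2 \<le> real_of_int \<lceil>4 / a\<^sup>2\<rceil>")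
    case True
    then show ?thesis by (rule early)
  next
    case False
    define m where "m = real n + 2"
    \<comment> \<open>Integrality closes the gap between the phases: if n + 3 exceeds the ceiling, n
      + 2 has reached it, and the step from n to n + 1 already meets the threshold of
      \<open>recursion_bound\<close>.\<close>
    have "\<not> int n + 3 \<le> \<lceil>4 / a\<^sup>2\<rceil>" using False by linarith
    then have "\<lceil>4 / a\<^sup>2\<rceil> \<le> int n + 2" by linarith
    then have m: "4 / a\<^sup>2 \<le> m" by (simp add: m_def ceiling_le_iff)
    have m0: "m > 0" by (simp add: m_def)
    have la: "2 * lam n * a = 2 / m" "lam n = 1 / (a * m)"
      using a_pos by (simp_all add: lam m_def)
    have "(\<integral>w. (D (Suc n) w)\<^sup>2 \<partial>P) \<le> u / (m + 1)"
    proof (rule recursion_bound[OF a_pos a_le_1 m _ _ c_le])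
      show "(\<integral>w. (D n w)\<^sup>2 \<partial>P) \<le> u / m" using IH by (simp add: m_def)
      show "4 * \<sigma> + 2 * c \<le> u" by (simp add: u)
      show "(1 + 2 / m) * (\<integral>w. (D (Suc n) w)\<^sup>2 \<partial>P) \<le> (\<integral>w. (D n w)\<^sup>2 \<partial>P) +
        (1 / (a * m))\<^sup>2 * ((max 1 (2 * a) - 1 + 2 / m) * \<sigma> +
          (2 * C + 8 * (a - a\<^sup>2) * (\<integral>w. (D n w)\<^sup>2 \<partial>P)) / max 1 (2 * a))"
        using strong_step_integral[of "max 1 (2 * a)" n] a_pos unfolding la by simp
    qed (use c c_pos \<sigma>_nonneg in auto)
    then show ?thesis by (simp add: m_def add_ac)
  qed
  with zero show ?thesis by (induction n) blast+
qed

text \<open>The tail of the step sizes contributes \<open>2 * c / a^2\<close>, which is at most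
  \<open>2 * \<Lambda> * u\<close>. The exponential enters only through
  \<open>1 + 2 * \<Lambda> <= exp (2 * \<Lambda>)\<close>.\<close>

theorem tail_bound:
  assumes eps: "\<epsilon> > 0"
  shows "prob {w\<in>space P. \<exists>m\<ge>n. (D m w)\<^sup>2 \<ge> \<epsilon>} \<le>
    1 / \<epsilon> * (exp (2 * \<Lambda>) * (u + 4 * \<sigma> + 2 * c) / (real n + 2))"
proof -
  have a2: "0 < a\<^sup>2" "a\<^sup>2 \<le> 1" using a_le_1 a_pos by (auto intro: power_le_one)
  have u0: "u \<ge> 0" using c_pos \<sigma>_nonneg by (simp add: u)
  have "a^4 \<le> 1" using a_le_1 a_pos by (intro power_le_one) auto
  then have "a^4 * u \<le> 1 * u" using u0 by (intro mult_right_mono)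
  then have uc: "5 / 2 * c \<le> u" using c_le by simp
  have "\<epsilon> * prob {w\<in>space P. \<exists>m\<ge>n. (D m w)\<^sup>2 \<ge> \<epsilon>}
      \<le> (\<integral>w. (D n w)\<^sup>2 \<partial>P) + C * (\<Sum>i. (lam (i + n))\<^sup>2)"
    by (rule maximal_inequality[OF eps lam_summable])
  also have "\<dots> \<le> u / (real n + 2) + c * (1 / a\<^sup>2 * (2 / (real n + 2)))"
    using mean_square_bound lam_tail c C_nonneg c_pos
    by (intro add_mono mult_mono) (auto intro!: suminf_nonneg summable_ignore_initial_segment lam_summable)
  also have "\<dots> = (u + 2 * c / a\<^sup>2) / (real n + 2)"
    by (simp add: add_divide_distrib)
  also have "\<dots> \<le> exp (2 * \<Lambda>) * (u + 4 * \<sigma> + 2 * c) / (real n + 2)"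
  proof (rule divide_right_mono)
    \<comment> \<open>The two factors on the right are lower bounds for \<open>2 * \<Lambda>\<close>
      and u; numerically this is 2 <= 25/8.\<close>
    have "2 * c / a\<^sup>2 \<le> (5 / 4 / a\<^sup>2) * (5 / 2 * c)" using c_pos a2 by (simp add: divide_simps)
    also have "\<dots> \<le> 2 * \<Lambda> * u" using uc \<Lambda>_ge \<Lambda>_pos c_pos a2 by (intro mult_mono) auto
    finally have "u + 2 * c / a\<^sup>2 \<le> (1 + 2 * \<Lambda>) * u" by (simp add: distrib_right)
    also have "\<dots> \<le> exp (2 * \<Lambda>) * (u + 4 * \<sigma> + 2 * c)"
      using exp_ge_add_one_self[of "2 * \<Lambda>"] u0 \<sigma>_nonneg c_pos by (intro mult_mono) auto
    finally show "u + 2 * c / a\<^sup>2 \<le> exp (2 * \<Lambda>) * (u + 4 * \<sigma> + 2 * c)" .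
  qed simp
  finally have "prob {w\<in>space P. \<exists>m\<ge>n. (D m w)\<^sup>2 \<ge> \<epsilon>} \<le>
      exp (2 * \<Lambda>) * (u + 4 * \<sigma> + 2 * c) / (real n + 2) / \<epsilon>"
    using eps by (subst pos_le_divide_eq) (simp_all only: mult.commute)
  then show ?thesis by (simp only: divide_inverse_commute mult_1_right inverse_eq_divide[symmetric] times_divide_eq_left)
qed

end
end

section \<open>The proximal iteration as a stochastic descent\<close>

text \<open>The moment bounds in (A4) and in the conclusion use the nonnegative integral: a Bochner
  integral is 0 for a non-integrable function, and a bound on it would not assert
  finiteness.\<close>

theorem mainTheorem11:
  fixes mu :: "'e measure" and P :: "'w measure"
    and A :: "'e \<Rightarrow> 'a::{complete_space, second_countable_topology} \<Rightarrow> 'a tvec set"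
    and \<xi> :: "nat \<Rightarrow> 'w \<Rightarrow> 'e"
    and x0 xstar :: 'a and \<phi>star :: "'e \<Rightarrow> 'a tvec"
    and \<alpha> :: "'e \<Rightarrow> real"
    and \<sigma> \<Lambda> c b :: real
  defines "\<alpha>bar \<equiv> integral\<^sup>L mu \<alpha>"
  defines "lam \<equiv> (\<lambda>n::nat. 1 / (\<alpha>bar * (real n + 2)))"
  defines "x \<equiv> ppa_iter A x0 lam \<xi>"
  defines "u \<equiv> max (4 * \<sigma> + 2 * c) (real_of_int \<lceil>4 / \<alpha>bar\<^sup>2\<rceil> * (b + c * \<Lambda>))"
  assumes hadamard: "hadamard TYPE('a)"
    and tsep: "\<forall>y::'a. tangent_separable y"
    and probE: "prob_space mu" and probP: "prob_space P"
    and rmvf: "random_monotone_vf mu A"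
    \<comment> \<open>(A0): i.i.d. with distribution mu (the step-size conditions hold for lam)\<close>
    and iid: "prob_space.indep_vars P (\<lambda>_. mu) \<xi> {1..}"
    and distr: "\<forall>n\<ge>1. distr P mu (\<xi> n) = mu"
    \<comment> \<open>(A1)\<close>
    and \<alpha>_meas: "\<alpha> \<in> borel_measurable mu"
    and \<alpha>_range: "\<forall>s\<in>space mu. 0 < \<alpha> s \<and> \<alpha> s \<le> 1"
    and \<alpha>bar_pos: "\<alpha>bar > 0"
    and strong: "\<forall>s\<in>space mu. strongly_monotone_vf (A s) (\<alpha> s)"
    \<comment> \<open>(A2)\<close>
    and zero_mean: "tmem xstar (tzero xstar) (mean_field mu A xstar)"
    and xstar_Z: "xstar \<in> zeros2 mu A"
    and \<phi>star_sel: "\<phi>star \<in> selections 2 mu A xstar"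
    and \<phi>star_int: "tbarycenter mu xstar \<phi>star (tzero xstar)"
    \<comment> \<open>(A3)\<close>
    and A3: "\<forall>n. AE \<omega> in P. real_cond_exp P (nat_filtration P mu \<xi> n)
               (\<lambda>\<omega>. tinner xstar (\<phi>star (\<xi> (Suc n) \<omega>)) (tlog xstar (x n \<omega>))) \<omega> = 0"
    \<comment> \<open>(A4)\<close>
    and \<sigma>_pos: "\<sigma> > 0"
    and A4: "\<forall>n. (\<integral>\<^sup>+\<omega>. ennreal ((tnorm (x (Suc n) \<omega>) (yosida (A (\<xi> (Suc n) \<omega>)) (lam n) (x n \<omega>)))\<^sup>2) \<partial>P)
               \<le> ennreal \<sigma>"
    and \<Lambda>: "\<Lambda> > (\<Sum>n. (lam n)\<^sup>2)"
    and c: "c > 0" "c > (\<integral>s. (tnorm xstar (\<phi>star s))\<^sup>2 \<partial>mu)"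
    and b: "b \<ge> (\<integral>\<omega>. (dist x0 xstar)\<^sup>2 \<partial>P)"
  shows "(\<forall>n. (\<integral>\<^sup>+\<omega>. ennreal ((dist (x n \<omega>) xstar)\<^sup>2) \<partial>P) \<le> ennreal (u / (real n + 2))) \<and>
         (\<forall>n. \<forall>\<epsilon>>0. measure P {\<omega>\<in>space P. \<exists>m\<ge>n. (dist (x m \<omega>) xstar)\<^sup>2 \<ge> \<epsilon>}
           \<le> (1 / \<epsilon>) * (exp (2 * \<Lambda>) * (u + 4 * \<sigma> + 2 * c) / (real n + 2)))"
proof -
  interpret hadamard_space "TYPE('a)" by unfold_locales (rule hadamard)
  interpret P: prob_space P by (rule probP)
  define D where "D n \<omega> = dist (x n \<omega>) xstar" for n \<omega>
  define \<delta> where "\<delta> n \<omega> = dist (x (Suc n) \<omega>) (x n \<omega>)" for n \<omega>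
  define \<Phi> where "\<Phi> s = tnorm xstar (\<phi>star s)" for s
  define G where "G n \<omega> = tinner xstar (\<phi>star (\<xi> (Suc n) \<omega>)) (tlog xstar (x n \<omega>))" for n \<omega>
  have A: "vfield (A s)" "monotone_vf (A s)" "surjectivity_cond (A s)" if "s \<in> space mu" for s
    using rmvf that unfolding random_monotone_vf_def by blast+
  have lam: "lam n > 0" for n
    using \<alpha>bar_pos by (simp add: lam_def)
  have \<phi>T: "\<phi>star s \<in> tangent xstar" "tmem xstar (\<phi>star s) (A s xstar)" if "s \<in> space mu" for s
    using \<phi>star_sel that unfolding selections_def tLp_def tmeasurable_def by auto
  have \<phi>_meas: "(\<lambda>s. tdist xstar (\<phi>star s) v) \<in> borel_measurable mu" if "v \<in> tangent xstar" for v
    using \<phi>star_sel that unfolding selections_def tLp_def tmeasurable_def by auto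
  \<comment> \<open>Measurability of \<phi>star is known through distances only: its norm is the
    distance to the zero vector, and its inner products come from polarization.\<close>
  have \<Phi>_meas[measurable]: "\<Phi> \<in> borel_measurable mu"
    using \<phi>_meas[OF tzero_tangent]
    by (rule measurable_cong[THEN iffD1, rotated]) (simp add: \<Phi>_def tdist_tzero \<phi>T)
  have inner_meas: "(\<lambda>s. tinner xstar (\<phi>star s) (tlog xstar w)) \<in> borel_measurable mu" for w
  proof -
    note [measurable] = \<phi>_meas[OF tlog_tangent[of xstar w]]
    have "(\<lambda>s. ((\<Phi> s)\<^sup>2 + (dist xstar w)\<^sup>2 - (tdist xstar (\<phi>star s) (tlog xstar w))\<^sup>2) / 2) \<in> borel_measurable mu"
      by measurable
    then show ?thesis
      by (rule measurable_cong[THEN iffD1, rotated]) (simp add: \<Phi>_def tdist_tlog_sq \<phi>T)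
  qed
  have \<xi>_meas: "\<xi> i \<in> measurable P mu" if "i \<ge> 1" for i
    using iid that unfolding P.indep_vars_def2 by auto
  have \<xi>_space: "\<xi> (Suc n) \<omega> \<in> space mu" if "\<omega> \<in> space P" for n \<omega>
    using measurable_space[OF \<xi>_meas[of "Suc n"] that] by simp
  have x_Suc: "x (Suc n) \<omega> = resolvent (A (\<xi> (Suc n) \<omega>)) (lam n) (x n \<omega>)" for n \<omega>
    by (simp add: x_def)
  \<comment> \<open>Adaptedness is the point here, because the independence of \<open>D n\<close>
    from the next sample rests on it. Resolvents are measurable in the sample and continuous in the
    point.\<close>
  have x_meas: "x n \<in> borel_measurable (nat_filtration P mu \<xi> n)" for n
  proof (induction n)
    case 0
    show ?case by (simp add: x_def)
  next
    case (Suc n)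
    have "(\<lambda>\<omega>. resolvent (A (\<xi> (Suc n) \<omega>)) (lam n) (x n \<omega>)) \<in> borel_measurable (nat_filtration P mu \<xi> (Suc n))"
    proof (rule borel_measurable_caratheodory[where M = mu and f = "\<lambda>s. resolvent (A s) (lam n)"])
      show "(\<lambda>s. resolvent (A s) (lam n) y) \<in> borel_measurable mu" for y
        using rmvf lam unfolding random_monotone_vf_def by blast
      show "continuous_on UNIV (resolvent (A s) (lam n))" if "s \<in> space mu" for s
        by (rule continuous_resolvent[OF A[OF that] lam])
      show "\<xi> (Suc n) \<in> measurable (nat_filtration P mu \<xi> (Suc n)) mu"
        by (rule measurable_nat_filtration) (auto intro: \<xi>_meas)
      show "x n \<in> borel_measurable (nat_filtration P mu \<xi> (Suc n))"
        by (rule measurable_nat_filtration_mono[OF Suc]) simp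
    qed
    then show ?case by (simp add: x_Suc[abs_def])
  qed
  have [measurable]: "x n \<in> borel_measurable P" for n
    by (rule measurable_from_subalg[OF subalgebra_nat_filtration x_meas]) (auto intro: \<xi>_meas)
  have \<delta>_meas[measurable]: "\<delta> n \<in> borel_measurable P" for n
    unfolding \<delta>_def by measurable
  \<comment> \<open>(A4) bounds the step length divided by \<open>lam n\<close>; multiplying by
    \<open>(lam n)^2\<close> yields the locale's bound on \<delta>.\<close>
  have norm: "tnorm (x (Suc n) \<omega>) (yosida (A (\<xi> (Suc n) \<omega>)) (lam n) (x n \<omega>)) = \<delta> n \<omega> / lam n" for n \<omega>
    by (simp add: x_Suc \<delta>_def tnorm_yosida[OF lam])
  interpret S: stochastic_descent P mu \<xi> \<alpha> \<Phi> D \<delta> G lam \<sigma>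
  proof (rule stochastic_descent.intro[OF probP], rule stochastic_descent_axioms.intro)
    show "D n \<in> borel_measurable (nat_filtration P mu \<xi> n)" for n
      unfolding D_def using x_meas[of n] by measurable
    show "integrable mu (\<lambda>s. (\<Phi> s)\<^sup>2)"
      using \<phi>star_sel unfolding selections_def tLp_def \<Phi>_def by auto
    show "(\<integral>\<^sup>+\<omega>. ennreal ((\<delta> n \<omega>)\<^sup>2) \<partial>P) \<le> ennreal ((lam n)\<^sup>2 * \<sigma>)" for n
    proof -
      have "(\<integral>\<^sup>+\<omega>. ennreal ((\<delta> n \<omega>)\<^sup>2) \<partial>P) = (\<integral>\<^sup>+\<omega>. ennreal ((lam n)\<^sup>2) * ennreal ((\<delta> n \<omega> / lam n)\<^sup>2) \<partial>P)"
        using lam[of n] by (simp add: ennreal_mult[symmetric] power_divide)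
      also have "\<dots> = ennreal ((lam n)\<^sup>2) * (\<integral>\<^sup>+\<omega>. ennreal ((\<delta> n \<omega> / lam n)\<^sup>2) \<partial>P)"
        by (rule nn_integral_cmult) measurable
      also have "\<dots> \<le> ennreal ((lam n)\<^sup>2) * ennreal \<sigma>"
        using A4 by (intro mult_left_mono) (auto simp: norm)
      finally show ?thesis using \<sigma>_pos by (simp add: ennreal_mult)
    qed
    show "G n \<in> borel_measurable P" for n
      unfolding G_def
    \<comment> \<open>The Caratheodory argument again, now with Lipschitz constant
      \<open>\<Phi> s\<close> in the point.\<close>
    proof (rule borel_measurable_caratheodory[where M = mu and f = "\<lambda>s y. tinner xstar (\<phi>star s) (tlog xstar y)"])
      show "continuous_on UNIV (\<lambda>y. tinner xstar (\<phi>star s) (tlog xstar y))" if s: "s \<in> space mu" for s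
        by (rule lipschitz_on_continuous_on[of "\<Phi> s"], rule lipschitz_onI)
          (auto simp: dist_real_def \<Phi>_def tinner_lipschitz tnorm_nonneg \<phi>T[OF s])
    qed (auto intro: inner_meas \<xi>_meas)
    show "AE \<omega> in P. real_cond_exp P (nat_filtration P mu \<xi> n) (G n) \<omega> = 0" for n
      using A3 unfolding G_def by blast
    fix n \<omega> assume w: "\<omega> \<in> space P"
    note s = \<xi>_space[OF w, of n]
    show "\<bar>G n \<omega>\<bar> \<le> \<Phi> (\<xi> (Suc n) \<omega>) * D n \<omega>"
      unfolding G_def \<Phi>_def D_def using abs_tinner_tlog_le[OF \<phi>T(1)[OF s], of "x n \<omega>"] by (simp add: dist_commute)
    show "(1 + 2 * lam n * \<alpha> (\<xi> (Suc n) \<omega>)) * (D (Suc n) \<omega>)\<^sup>2 \<le>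
      (D n \<omega>)\<^sup>2 - 2 * lam n * G n \<omega> - (\<delta> n \<omega>)\<^sup>2 + 2 * lam n * \<Phi> (\<xi> (Suc n) \<omega>) * \<delta> n \<omega>"
      unfolding D_def G_def \<delta>_def \<Phi>_def x_Suc
      by (rule resolvent_step[OF A[OF s] lam _ \<phi>T[OF s]]) (use strong s in blast)
    show "\<bar>D (Suc n) \<omega> - D n \<omega>\<bar> \<le> \<delta> n \<omega>"
      unfolding D_def \<delta>_def
      using abs_dist_diff_le[of "x (Suc n) \<omega>" xstar "x n \<omega>"] by (simp only: dist_commute[of xstar])
  next
    show "integrable P (\<lambda>\<omega>. (D 0 \<omega>)\<^sup>2)" by (simp add: D_def x_def)
    show "prob_space mu" by (rule probE)
    show "P.indep_vars (\<lambda>_. mu) \<xi> {1..}" by (rule iid)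
    show "\<Phi> s \<ge> 0" if "s \<in> space mu" for s
      unfolding \<Phi>_def by (rule tnorm_nonneg[OF \<phi>T(1)[OF that]])
    show "distr P mu (\<xi> n) = mu" if "n \<ge> 1" for n using distr that by blast
    show "\<alpha> \<in> borel_measurable mu" by (rule \<alpha>_meas)
    show "0 < \<alpha> s \<and> \<alpha> s \<le> 1" if "s \<in> space mu" for s using \<alpha>_range that by blast
    show "\<Phi> \<in> borel_measurable mu" by (rule \<Phi>_meas)
    show "\<delta> n \<in> borel_measurable P" for n by (rule \<delta>_meas)
    show "0 \<le> D n \<omega>" "0 \<le> \<delta> n \<omega>" for n \<omega> by (simp_all add: D_def \<delta>_def)
    show "0 \<le> \<sigma>" using \<sigma>_pos by simp
    show "0 < lam n" for n by (rule lam)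
  qed
  have a: "S.a = \<alpha>bar" by (simp add: S.a_def \<alpha>bar_def)
  have C: "S.C < c" using c by (simp add: S.C_def \<Phi>_def)
  have D0: "(\<integral>\<omega>. (D 0 \<omega>)\<^sup>2 \<partial>P) \<le> b" using b by (simp add: D_def x_def)
  have lam': "lam n = 1 / (S.a * (real n + 2))" for n by (simp add: a lam_def)
  have u': "u = max (4 * \<sigma> + 2 * c) (real_of_int \<lceil>4 / S.a\<^sup>2\<rceil> * (b + c * \<Lambda>))"
    by (simp add: a u_def)
  have pos: "S.a > 0" using \<alpha>bar_pos by (simp add: a)
  show ?thesis
  proof (intro conjI allI impI)
    fix n
    have "(\<integral>\<^sup>+\<omega>. ennreal ((dist (x n \<omega>) xstar)\<^sup>2) \<partial>P) = ennreal (\<integral>\<omega>. (D n \<omega>)\<^sup>2 \<partial>P)"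
      using nn_integral_eq_integral[OF S.D_sq_integrable[of n]] by (simp add: D_def)
    also have "\<dots> \<le> ennreal (u / (real n + 2))"
      by (rule ennreal_leI, rule S.mean_square_bound[OF pos lam' \<Lambda> C D0 u'])
    finally show "(\<integral>\<^sup>+\<omega>. ennreal ((dist (x n \<omega>) xstar)\<^sup>2) \<partial>P) \<le> ennreal (u / (real n + 2))" .
  next
    fix n and \<epsilon> :: real assume "\<epsilon> > 0"
    then show "measure P {\<omega>\<in>space P. \<exists>m\<ge>n. (dist (x m \<omega>) xstar)\<^sup>2 \<ge> \<epsilon>}
           \<le> (1 / \<epsilon>) * (exp (2 * \<Lambda>) * (u + 4 * \<sigma> + 2 * c) / (real n + 2))"
      using S.tail_bound[OF pos lam' \<Lambda> C D0 u', of \<epsilon> n] by (simp add: D_def)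
  qed
qed

end
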